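(* Let $U$ and $V$ be persistence modules of finite type indexed by $\mathbb{R}$. For every $\varepsilon\ge 0$, there exists an $\varepsilon$-interleaving between $U$ and $V$ if and only if there exists an $\varepsilon$-matching between the barcodes $\mathrm{bar}(U)$ and $\mathrm{bar}(V)$. This implies $$d_I(U,V)=d_B(\mathrm{bar}(U),\mathrm{bar}(V)).$$
   Context: Fix a field $F$; all vector spaces are over $F$. A persistence module $V$ indexed by $\mathbb{R}$ is a functor from the poset $\mathbb{R}$ to vector spaces, with spaces $V_t$ and structure maps $V_{s\le t}$; morphisms are natural transformations; direct sums are pointwise. Decorated reals: $\mathbb{R}\times\{-,+\}$ with lexicographic order, $-<+$; write $t^\pm$, and add bottom and top elements $-\infty,\infty$. For such $b\le d$, $\lceil b,d\rfloor\subseteq\mathbb{R}$ is the interval with these endpoints: a lower endpoint $s^-$ is closed, $s^+$ is open; an upper endpoint $t^+$ is closed, $t^-$ is open; $\pm\infty$ are unbounded ends. Put $s^\pm+t=(s+t)^\pm$ and $\pm\infty+t=\pm\infty$. For a nonempty interval $L$, the interval module $\mathbb{I}(L)$ is $F$ at $t\in L$ and $0$ elsewhere, with identity structure maps inside $L$ and zero maps otherwise. A module is of finite type if it is isomorphic to a finite direct sum $\bigoplus_{i\in I}\mathbb{I}(L_i)$; the multiset $\{L_i\}_{i\in I}$ is unique and is the barcode $\mathrm{bar}(V)$, with members called bars. $V_{\_+\varepsilon}$ is the module with $t$ component $V_{t+\varepsilon}$ and structure maps $V_{s+\varepsilon\le t+\varepsilon}$. For $\varepsilon\ge0$, an $\varepsilon$-interleaving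 between $U$ and $V$ is a pair of morphisms $\varphi\colon U\to V_{\_+\varepsilon}$, $\psi\colon V\to U_{\_+\varepsilon}$ with $\psi_{t+\varepsilon}\circ\varphi_t=U_{t\le t+2\varepsilon}$ and $\varphi_{t+\varepsilon}\circ\psi_t=V_{t\le t+2\varepsilon}$ for all $t$. $d_I(U,V)=\inf\{\varepsilon>0\mid$ there exists an $\varepsilon$-interleaving between $U$ and $V\}$. A matching of barcodes $\{\lceil b_i,d_i\rfloor\}_{i\in I}$ and $\{\lceil b'_j,d'_j\rfloor\}_{j\in J}$ is a subset $M\subseteq I\times J$ in which each $i$ and each $j$ occurs at most once. It is an $\varepsilon$-matching if (1) every bar in either barcode that contains a closed interval of length $2\varepsilon$ is matched, and (2) for all $(i,j)\in M$, $\lceil b_i,d_i\rfloor\subseteq\lceil b'_j-\varepsilon,d'_j+\varepsilon\rfloor$ and $\lceil b'_j,d'_j\rfloor\subseteq\lceil b_i-\varepsilon,d_i+\varepsilon\rfloor$. $d_B$ of two barcodes is $\inf\{\varepsilon>0\mid$ there exists an $\varepsilon$-matching between them$\}$. The infimum of the empty set is $\infty$. *)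

theory Defs
  imports "HOL-Library.Multiset" "HOL-Library.Extended_Real" "HOL-Algebra.Module"
begin

section \<open>Persistence modules indexed by the reals\<close>

text \<open>The ground field is a ring record \<^term>\<open>F\<close> with \<^prop>\<open>field F\<close>; a vector space over
  \<^term>\<open>F\<close> is an \<^term>\<open>M\<close> with \<^prop>\<open>Module.module F M\<close>. The fields \<^term>\<open>mult\<close> and
  \<^term>\<open>one\<close> of a module record play no role. Structure maps and components of morphisms are
  relevant only on carriers, and structure maps \<^term>\<open>smap V s t\<close> only for \<^prop>\<open>s \<le> t\<close>.\<close>

definition linear_maps ::
    "('a, 'm) ring_scheme \<Rightarrow> ('a, 'v) module \<Rightarrow> ('a, 'w) module \<Rightarrow> ('v \<Rightarrow> 'w) set" where
  "linear_maps F M N =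
    {f \<in> hom (add_monoid M) (add_monoid N).
       \<forall>a\<in>carrier F. \<forall>x\<in>carrier M. f (a \<odot>\<^bsub>M\<^esub> x) = a \<odot>\<^bsub>N\<^esub> f x}"

record ('a, 'v) pmod =
  vspace :: "real \<Rightarrow> ('a, 'v) module"
  smap :: "real \<Rightarrow> real \<Rightarrow> 'v \<Rightarrow> 'v"

locale persistence_module =
  fixes F :: "('a, 'm) ring_scheme" and V :: "('a, 'v) pmod"
  assumes field: "field F"
    and space_module: "Module.module F (vspace V t)"
    and smap_linear: "s \<le> t \<Longrightarrow> smap V s t \<in> linear_maps F (vspace V s) (vspace V t)"
    and smap_id: "x \<in> carrier (vspace V t) \<Longrightarrow> smap V t t x = x"
    and smap_comp: "\<lbrakk>r \<le> s; s \<le> t; x \<in> carrier (vspace V r)\<rbrakk>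
      \<Longrightarrow> smap V s t (smap V r s x) = smap V r t x"

definition pmorphism ::
    "('a, 'm) ring_scheme \<Rightarrow> ('a, 'v) pmod \<Rightarrow> ('a, 'w) pmod \<Rightarrow> (real \<Rightarrow> 'v \<Rightarrow> 'w) \<Rightarrow> bool" where
  "pmorphism F U V f \<longleftrightarrow>
    (\<forall>t. f t \<in> linear_maps F (vspace U t) (vspace V t)) \<and>
    (\<forall>s t. s \<le> t \<longrightarrow> (\<forall>x\<in>carrier (vspace U s). f t (smap U s t x) = smap V s t (f s x)))"

definition pisomorphic ::
    "('a, 'm) ring_scheme \<Rightarrow> ('a, 'v) pmod \<Rightarrow> ('a, 'w) pmod \<Rightarrow> bool" where
  "pisomorphic F U V \<longleftrightarrow>
    (\<exists>f g. pmorphism F U V f \<and> pmorphism F V U g \<and>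
      (\<forall>t. \<forall>x\<in>carrier (vspace U t). g t (f t x) = x) \<and>
      (\<forall>t. \<forall>y\<in>carrier (vspace V t). f t (g t y) = y))"

text \<open>For a finite index set \<^term>\<open>I\<close>, which is the only case used, the full product of the
  spaces is their direct sum.\<close>

definition direct_sum :: "'i set \<Rightarrow> ('i \<Rightarrow> ('a, 'v) pmod) \<Rightarrow> ('a, 'i \<Rightarrow> 'v) pmod" where
  "direct_sum I V =
    \<lparr>vspace = (\<lambda>t.
       \<lparr>carrier = (\<Pi>\<^sub>E i\<in>I. carrier (vspace (V i) t)),
        mult = (\<lambda>x y. \<lambda>i\<in>I. x i \<otimes>\<^bsub>vspace (V i) t\<^esub> y i),
        one = (\<lambda>i\<in>I. \<one>\<^bsub>vspace (V i) t\<^esub>),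
        zero = (\<lambda>i\<in>I. \<zero>\<^bsub>vspace (V i) t\<^esub>),
        add = (\<lambda>x y. \<lambda>i\<in>I. x i \<oplus>\<^bsub>vspace (V i) t\<^esub> y i),
        smult = (\<lambda>a x. \<lambda>i\<in>I. a \<odot>\<^bsub>vspace (V i) t\<^esub> x i)\<rparr>),
     smap = (\<lambda>s t x. \<lambda>i\<in>I. smap (V i) s t (x i))\<rparr>"

definition pshift :: "real \<Rightarrow> ('a, 'v) pmod \<Rightarrow> ('a, 'v) pmod" where
  "pshift \<epsilon> V = \<lparr>vspace = (\<lambda>t. vspace V (t + \<epsilon>)), smap = (\<lambda>s t. smap V (s + \<epsilon>) (t + \<epsilon>))\<rparr>"


section \<open>Decorated reals and intervals\<close>

text \<open>\<^term>\<open>DMinus t\<close> and \<^term>\<open>DPlus t\<close> stand for $t^-$ and $t^+$; \<^term>\<open>DBot\<close> and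
  \<^term>\<open>DTop\<close> for $-\infty$ and $\infty$.\<close>

datatype dreal = DBot | DMinus real | DPlus real | DTop

instantiation dreal :: linorder
begin

fun less_eq_dreal :: "dreal \<Rightarrow> dreal \<Rightarrow> bool" where
  "less_eq_dreal DBot y = True"
| "less_eq_dreal x DTop = True"
| "less_eq_dreal (DMinus s) (DMinus t) = (s \<le> t)"
| "less_eq_dreal (DMinus s) (DPlus t) = (s \<le> t)"
| "less_eq_dreal (DPlus s) (DMinus t) = (s < t)"
| "less_eq_dreal (DPlus s) (DPlus t) = (s \<le> t)"
| "less_eq_dreal x y = False"

definition less_dreal :: "dreal \<Rightarrow> dreal \<Rightarrow> bool" where
  "less_dreal x y \<longleftrightarrow> x \<le> y \<and> \<not> y \<le> x"

instance
proof
  fix x y z :: dreal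
  show "x < y \<longleftrightarrow> x \<le> y \<and> \<not> y \<le> x" by (rule less_dreal_def)
  show "x \<le> x" by (cases x) auto
  show "x \<le> y \<Longrightarrow> y \<le> z \<Longrightarrow> x \<le> z" by (cases x; cases y; cases z) auto
  show "x \<le> y \<Longrightarrow> y \<le> x \<Longrightarrow> x = y" by (cases x; cases y) auto
  show "x \<le> y \<or> y \<le> x" by (cases x; cases y) auto
qed

end

fun dshift :: "dreal \<Rightarrow> real \<Rightarrow> dreal" where
  "dshift DBot t = DBot"
| "dshift (DMinus s) t = DMinus (s + t)"
| "dshift (DPlus s) t = DPlus (s + t)"
| "dshift DTop t = DTop"

fun above_lower :: "dreal \<Rightarrow> real \<Rightarrow> bool" where
  "above_lower DBot t = True"
| "above_lower (DMinus s) t = (s \<le> t)"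
| "above_lower (DPlus s) t = (s < t)"
| "above_lower DTop t = False"

fun below_upper :: "real \<Rightarrow> dreal \<Rightarrow> bool" where
  "below_upper t DBot = False"
| "below_upper t (DMinus s) = (t < s)"
| "below_upper t (DPlus s) = (t \<le> s)"
| "below_upper t DTop = True"

definition dinterval :: "dreal \<Rightarrow> dreal \<Rightarrow> real set" where
  "dinterval b d = {t. above_lower b t \<and> below_upper t d}"

definition nonempty_interval :: "real set \<Rightarrow> bool" where
  "nonempty_interval L \<longleftrightarrow> L \<noteq> {} \<and> (\<exists>b d. b \<le> d \<and> L = dinterval b d)"

lemma dinterval_nonempty_iff: "dinterval b d \<noteq> {} \<longleftrightarrow> b < d"
proof (cases "b = DBot \<or> d = DTop \<or> b = DTop \<or> d = DBot")
  case True
  then show ?thesis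
    by (cases b; cases d)
       (auto simp: dinterval_def less_dreal_def intro: lt_ex gt_ex le_less_trans order_refl)
next
  case False
  show ?thesis
  proof
    assume "dinterval b d \<noteq> {}"
    with False show "b < d" by (cases b; cases d) (auto simp: dinterval_def less_dreal_def)
  next
    assume less: "b < d"
    with False show "dinterval b d \<noteq> {}"
      by (cases b; cases d) (auto simp: dinterval_def less_dreal_def intro: dense,
          meson linorder_not_le order_refl)
  qed
qed

lemma dinterval_unique:
  assumes "dinterval b d = dinterval b' d'" "dinterval b d \<noteq> {}"
  shows "b = b' \<and> d = d'"
proof -
  have key: "\<not> b1 < b2" if e: "dinterval b1 d1 = dinterval b2 d2" and n: "dinterval b1 d1 \<noteq> {}" for b1 d1 b2 d2
  proof
    assume l: "b1 < b2"
    define e where "e = min b2 d1"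
    have "b1 < d1" using n dinterval_nonempty_iff by blast
    hence "b1 < e" using l e_def by simp
    hence "dinterval b1 e \<noteq> {}" using dinterval_nonempty_iff by blast
    then obtain t where "t \<in> dinterval b1 e" by blast
    hence "t \<in> dinterval b1 d1 \<and> \<not> above_lower b2 t"
      unfolding e_def min_def by (cases b1; cases b2; cases d1) (auto simp: dinterval_def split: if_splits)
    thus False using e by (auto simp: dinterval_def)
  qed
  have key2: "\<not> d1 < d2" if e: "dinterval b1 d1 = dinterval b2 d2" and n: "dinterval b1 d1 \<noteq> {}" for b1 d1 b2 d2
  proof
    assume l: "d1 < d2"
    define e where "e = max b2 d1"
    have "b2 < d2" using n e dinterval_nonempty_iff by metis
    hence "e < d2" using l e_def by simp
    hence "dinterval e d2 \<noteq> {}" using dinterval_nonempty_iff by blast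
    then obtain t where "t \<in> dinterval e d2" by blast
    hence "t \<in> dinterval b2 d2 \<and> \<not> below_upper t d1"
      unfolding e_def max_def by (cases b2; cases d2; cases d1) (auto simp: dinterval_def split: if_splits)
    thus False using e by (auto simp: dinterval_def)
  qed
  show ?thesis using key key2 assms by (metis linorder_neqE)
qed


section \<open>Interval modules and barcodes\<close>

definition interval_module :: "('a, 'm) ring_scheme \<Rightarrow> real set \<Rightarrow> ('a, 'a) pmod" where
  "interval_module F L =
    \<lparr>vspace = (\<lambda>t.
       \<lparr>carrier = (if t \<in> L then carrier F else {\<zero>\<^bsub>F\<^esub>}),
        mult = mult F, one = one F, zero = zero F, add = add F, smult = mult F\<rparr>),
     smap = (\<lambda>s t x. if s \<in> L \<and> t \<in> L then x else \<zero>\<^bsub>F\<^esub>)\<rparr>"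

definition interval_decomposition ::
    "('a, 'm) ring_scheme \<Rightarrow> ('a, 'v) pmod \<Rightarrow> nat set \<Rightarrow> (nat \<Rightarrow> real set) \<Rightarrow> bool" where
  "interval_decomposition F V I L \<longleftrightarrow>
    finite I \<and> (\<forall>i\<in>I. nonempty_interval (L i)) \<and>
    pisomorphic F V (direct_sum I (\<lambda>i. interval_module F (L i)))"

definition finite_type :: "('a, 'm) ring_scheme \<Rightarrow> ('a, 'v) pmod \<Rightarrow> bool" where
  "finite_type F V \<longleftrightarrow> (\<exists>I L. interval_decomposition F V I L)"

definition bar :: "('a, 'm) ring_scheme \<Rightarrow> ('a, 'v) pmod \<Rightarrow> real set multiset" where
  "bar F V = (THE B. \<exists>I L. interval_decomposition F V I L \<and> B = image_mset L (mset_set I))"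


section \<open>Interleavings and the interleaving distance\<close>

definition interleaving ::
    "('a, 'm) ring_scheme \<Rightarrow> real \<Rightarrow> ('a, 'v) pmod \<Rightarrow> ('a, 'w) pmod
      \<Rightarrow> (real \<Rightarrow> 'v \<Rightarrow> 'w) \<Rightarrow> (real \<Rightarrow> 'w \<Rightarrow> 'v) \<Rightarrow> bool" where
  "interleaving F \<epsilon> U V \<phi> \<psi> \<longleftrightarrow>
    pmorphism F U (pshift \<epsilon> V) \<phi> \<and> pmorphism F V (pshift \<epsilon> U) \<psi> \<and>
    (\<forall>t. \<forall>x\<in>carrier (vspace U t). \<psi> (t + \<epsilon>) (\<phi> t x) = smap U t (t + 2 * \<epsilon>) x) \<and>
    (\<forall>t. \<forall>y\<in>carrier (vspace V t). \<phi> (t + \<epsilon>) (\<psi> t y) = smap V t (t + 2 * \<epsilon>) y)"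

definition interleaved ::
    "('a, 'm) ring_scheme \<Rightarrow> real \<Rightarrow> ('a, 'v) pmod \<Rightarrow> ('a, 'w) pmod \<Rightarrow> bool" where
  "interleaved F \<epsilon> U V \<longleftrightarrow> (\<exists>\<phi> \<psi>. interleaving F \<epsilon> U V \<phi> \<psi>)"

definition interleaving_dist ::
    "('a, 'm) ring_scheme \<Rightarrow> ('a, 'v) pmod \<Rightarrow> ('a, 'w) pmod \<Rightarrow> ereal" where
  "interleaving_dist F U V = Inf {ereal \<epsilon> | \<epsilon>. \<epsilon> > 0 \<and> interleaved F \<epsilon> U V}"


section \<open>Matchings and the bottleneck distance\<close>

text \<open>The members of a multiset of bars counted with multiplicity: copy number \<^term>\<open>k\<close> of the
  bar \<^term>\<open>L\<close> is the pair \<^term>\<open>(L, k)\<close>.\<close>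

definition bar_index :: "real set multiset \<Rightarrow> (real set \<times> nat) set" where
  "bar_index B = {(L, k). k < count B L}"

text \<open>The endpoints of a nonempty interval are unique, so for bars the existential quantifiers
  below only give them names.\<close>

definition close_intervals :: "real \<Rightarrow> real set \<Rightarrow> real set \<Rightarrow> bool" where
  "close_intervals \<epsilon> L L' \<longleftrightarrow>
    (\<exists>b d b' d'. b \<le> d \<and> b' \<le> d' \<and> L = dinterval b d \<and> L' = dinterval b' d' \<and>
      L \<subseteq> dinterval (dshift b' (- \<epsilon>)) (dshift d' \<epsilon>) \<and>
      L' \<subseteq> dinterval (dshift b (- \<epsilon>)) (dshift d \<epsilon>))"

definition barcode_matching ::
    "real set multiset \<Rightarrow> real set multiset \<Rightarrow> ((real set \<times> nat) \<times> (real set \<times> nat)) set \<Rightarrow> bool" where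
  "barcode_matching B B' M \<longleftrightarrow>
    M \<subseteq> bar_index B \<times> bar_index B' \<and> single_valued M \<and> single_valued (M\<inverse>)"

definition eps_matching ::
    "real \<Rightarrow> real set multiset \<Rightarrow> real set multiset
      \<Rightarrow> ((real set \<times> nat) \<times> (real set \<times> nat)) set \<Rightarrow> bool" where
  "eps_matching \<epsilon> B B' M \<longleftrightarrow>
    barcode_matching B B' M \<and>
    (\<forall>i\<in>bar_index B. (\<exists>a. {a..a + 2 * \<epsilon>} \<subseteq> fst i) \<longrightarrow> i \<in> Domain M) \<and>
    (\<forall>j\<in>bar_index B'. (\<exists>a. {a..a + 2 * \<epsilon>} \<subseteq> fst j) \<longrightarrow> j \<in> Range M) \<and>
    (\<forall>(i, j)\<in>M. close_intervals \<epsilon> (fst i) (fst j))"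

definition eps_matched :: "real \<Rightarrow> real set multiset \<Rightarrow> real set multiset \<Rightarrow> bool" where
  "eps_matched \<epsilon> B B' \<longleftrightarrow> (\<exists>M. eps_matching \<epsilon> B B' M)"

definition bottleneck_dist :: "real set multiset \<Rightarrow> real set multiset \<Rightarrow> ereal" where
  "bottleneck_dist B B' = Inf {ereal \<epsilon> | \<epsilon>. \<epsilon> > 0 \<and> eps_matched \<epsilon> B B'}"

end

theory Submission
  imports Defs "HOL-Computational_Algebra.Polynomial"
begin

text \<open>A morphism between direct sums of interval modules is a matrix of scalars, and a nonzero entry
  forces inequalities between the endpoints of the two bars. Given an $\varepsilon$-interleaving, order
  by midpoint a set \<open>S\<close> of bars of one module that contain a closed interval of length $2\varepsilon$.
  The endpoint inequalities show that, on and to one side of the diagonal, the entries of the composed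
  matrix only receive contributions from bars of the other module that are $\varepsilon$-close to a
  member of \<open>S\<close>. As the composition is a structure map, this makes a unitriangular matrix factor
  through the span of these bars, so there are at least \<open>card S\<close> of them. This is Hall's condition;
  Hall's theorem, applied in both directions, gives two partial matchings, which are merged as in the
  Schroeder--Bernstein theorem. In the converse direction, matched bars are interleaved one by one.
  Uniqueness of the barcode is the case $\varepsilon = 0$ applied to two decompositions of the same
  module.\<close>

section \<open>Matchings in finite bipartite graphs\<close>

text \<open>The proof of Halmos and Vaughan: either some proper nonempty \<^term>\<open>S\<close> is critical, and
  \<^term>\<open>S\<close> and its complement are treated separately, or there is room to match one point
  arbitrarily.\<close>

theorem hall_marriage:
  assumes "finite A" and "\<And>i. i \<in> A \<Longrightarrow> finite (R i)"
    and "\<And>S. S \<subseteq> A \<Longrightarrow> card S \<le> card (\<Union>i\<in>S. R i)"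
  shows "\<exists>f. inj_on f A \<and> (\<forall>i\<in>A. f i \<in> R i)"
  using assms
proof (induction A arbitrary: R rule: finite_psubset_induct)
  case (psubset A)
  note fin = psubset.prems(1) and hall = psubset.prems(2)
  have finU: "finite (\<Union>i\<in>S. R i)" if "S \<subseteq> A" for S
    using that fin psubset.hyps finite_subset by blast
  consider "A = {}" | S where "S \<subset> A" "S \<noteq> {}" "card S = card (\<Union>i\<in>S. R i)"
    | "A \<noteq> {}" "\<And>S. S \<subset> A \<Longrightarrow> S \<noteq> {} \<Longrightarrow> card S < card (\<Union>i\<in>S. R i)"
    using hall by (metis le_neq_implies_less psubset_imp_subset)
  then show ?case
  proof cases
    case 1
    then show ?thesis by simp
  next
    case (2 S)
    have "\<exists>f. inj_on f S \<and> (\<forall>i\<in>S. f i \<in> R i)"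
    proof (rule psubset.IH[OF 2(1)])
      show "finite (R i)" if "i \<in> S" for i using that 2(1) fin by blast
      show "card T \<le> card (\<Union>i\<in>T. R i)" if "T \<subseteq> S" for T
        using that 2(1) by (intro hall) blast
    qed
    then obtain f where f: "inj_on f S" "\<forall>i\<in>S. f i \<in> R i" by blast
    \<comment> \<open>As \<open>S\<close> is critical, \<open>S\<close> together with any
      \<open>T \<subseteq> A - S\<close> reaches at least \<open>card T\<close> points beyond the
      neighbours of \<open>S\<close>. So Hall's condition survives on \<open>A - S\<close> when
      those neighbours are removed.\<close>
    define R' where "R' i = R i - (\<Union>i\<in>S. R i)" for i
    have "\<exists>g. inj_on g (A - S) \<and> (\<forall>i\<in>A - S. g i \<in> R' i)"
    proof (rule psubset.IH)
      show "A - S \<subset> A" using 2 by auto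
      show "finite (R' i)" if "i \<in> A - S" for i using that fin by (simp add: R'_def)
      fix T assume T: "T \<subseteq> A - S"
      have "card T + card S = card (T \<union> S)"
        using T 2(1) psubset.hyps
        by (intro card_Un_disjoint[symmetric]) (auto intro: finite_subset)
      also have "\<dots> \<le> card (\<Union>i\<in>T \<union> S. R i)"
        using T 2 by (intro hall) auto
      also have "(\<Union>i\<in>T \<union> S. R i) = (\<Union>i\<in>T. R' i) \<union> (\<Union>i\<in>S. R i)"
        by (auto simp: R'_def)
      also have "card \<dots> \<le> card (\<Union>i\<in>T. R' i) + card (\<Union>i\<in>S. R i)"
        by (rule card_Un_le)
      finally show "card T \<le> card (\<Union>i\<in>T. R' i)"
        using 2 by simp
    qed
    then obtain g where g: "inj_on g (A - S)" "\<forall>i\<in>A - S. g i \<in> R' i" by blast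
    have "inj_on (\<lambda>i. if i \<in> S then f i else g i) A"
    proof (rule inj_onI)
      have disj: "f i \<noteq> g k" if "i \<in> S" "k \<in> A" "k \<notin> S" for i k
      proof -
        have "f i \<in> (\<Union>i\<in>S. R i)" using f(2) that(1) by blast
        moreover have "g k \<notin> (\<Union>i\<in>S. R i)" using g(2) that by (simp add: R'_def)
        ultimately show ?thesis by metis
      qed
      fix i k
      assume "i \<in> A" "k \<in> A" "(if i \<in> S then f i else g i) = (if k \<in> S then f k else g k)"
      then show "i = k"
        using f(1) g(1) disj[of i k] disj[of k i]
        by (cases "i \<in> S"; cases "k \<in> S") (auto dest: inj_onD)
    qed
    moreover have "\<forall>i\<in>A. (if i \<in> S then f i else g i) \<in> R i"
      using f g by (auto simp: R'_def)
    ultimately show ?thesis by blast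
  next
    case 3
    from 3(1) obtain a where a: "a \<in> A" by blast
    have "R a \<noteq> {}"
      using hall[of "{a}"] a by auto
    then obtain y where y: "y \<in> R a" by blast
    have "\<exists>g. inj_on g (A - {a}) \<and> (\<forall>i\<in>A - {a}. g i \<in> R i - {y})"
    proof (rule psubset.IH)
      show "A - {a} \<subset> A" using a by auto
      show "finite (R i - {y})" if "i \<in> A - {a}" for i using that fin by simp
      fix T assume T: "T \<subseteq> A - {a}"
      show "card T \<le> card (\<Union>i\<in>T. R i - {y})"
      proof (cases "T = {}")
        case False
        with T a have "card T < card (\<Union>i\<in>T. R i)" by (intro 3(2)) auto
        also have "card (\<Union>i\<in>T. R i) \<le> card ((\<Union>i\<in>T. R i) - {y}) + 1"
          using diff_card_le_card_Diff[of "{y}" "\<Union>i\<in>T. R i"] by simp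
        also have "(\<Union>i\<in>T. R i) - {y} = (\<Union>i\<in>T. R i - {y})" by auto
        finally show ?thesis by simp
      qed simp
    qed
    then obtain g where g: "inj_on g (A - {a})" "\<forall>i\<in>A - {a}. g i \<in> R i - {y}" by blast
    have "inj_on (g(a := y)) A"
      using g by (auto simp: inj_on_def)
    moreover have "\<forall>i\<in>A. (g(a := y)) i \<in> R i"
      using g y by auto
    ultimately show ?thesis by blast
  qed
qed

text \<open>As in Banach's proof of the Schroeder--Bernstein theorem, \<^term>\<open>f\<close> is used on a fixed
  point \<^term>\<open>X\<close> of \<^term>\<open>\<lambda>X. S - g ` (T - f ` X)\<close> and \<^term>\<open>g\<close> outside of \<^term>\<open>f ` X\<close>.\<close>

lemma combine_matchings:
  assumes f: "inj_on f S" "\<And>i. i \<in> S \<Longrightarrow> (i, f i) \<in> E"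
    and g: "inj_on g T" "\<And>j. j \<in> T \<Longrightarrow> (g j, j) \<in> E"
  obtains M where "M \<subseteq> E" "single_valued M" "single_valued (M\<inverse>)" "S \<subseteq> Domain M" "T \<subseteq> Range M"
proof -
  define h where "h X = S - g ` (T - f ` X)" for X
  have "mono h"
    unfolding h_def by (intro monoI Diff_mono image_mono order_refl)
  then have "lfp h = h (lfp h)" by (rule lfp_unfold)
  from this h_def have "lfp h = S - g ` (T - f ` lfp h)" by (rule trans)
  then obtain X where X: "X = S - g ` (T - f ` X)" by (rule that)
  then have XS: "X \<subseteq> S" by blast
  have disj: "g j \<notin> X" if "j \<in> T" "j \<notin> f ` X" for j
    using X that by blast
  define M where "M = (\<lambda>i. (i, f i)) ` X \<union> (\<lambda>j. (g j, j)) ` (T - f ` X)"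
  show thesis
  proof
    show "M \<subseteq> E" using f g XS by (auto simp: M_def)
    show "single_valued M"
      using g(1) disj by (auto simp: M_def single_valued_def inj_on_def)
    show "single_valued (M\<inverse>)"
      using f(1) XS by (auto simp: M_def single_valued_def inj_on_def)
    show "S \<subseteq> Domain M"
    proof
      fix i assume "i \<in> S"
      then have "i \<in> X \<or> i \<in> g ` (T - f ` X)" using X by blast
      then show "i \<in> Domain M" by (auto simp: M_def)
    qed
    show "T \<subseteq> Range M"
    proof
      fix j assume "j \<in> T"
      then have "j \<in> f ` X \<or> j \<in> T - f ` X" by blast
      then show "j \<in> Range M" by (auto simp: M_def)
    qed
  qed
qed

section \<open>Decorated reals\<close>

lemma above_lower_iff: "above_lower b t \<longleftrightarrow> b \<le> DMinus t"
  by (cases b) auto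

lemma below_upper_iff: "below_upper t d \<longleftrightarrow> DPlus t \<le> d"
  by (cases d) auto

text \<open>A real \<open>t\<close> is seen as the gap between the adjacent cuts
  \<open>DMinus t\<close> and \<open>DPlus t\<close>. Questions about points become inequalities in
  the linear order on \<open>dreal\<close>, without cases for open, closed and unbounded
  ends.\<close>

lemma mem_dinterval: "t \<in> dinterval b d \<longleftrightarrow> b \<le> DMinus t \<and> DPlus t \<le> d"
  by (simp add: dinterval_def above_lower_iff below_upper_iff)

lemma dinterval_less: "t \<in> dinterval b d \<Longrightarrow> b < d"
  using dinterval_nonempty_iff by blast

lemma dinterval_ex: "b < d \<Longrightarrow> \<exists>t. b \<le> DMinus t \<and> DPlus t \<le> d"
  using dinterval_nonempty_iff[of b d] by (auto simp: mem_dinterval)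

lemma DMinus_less_DPlus: "DMinus t < DPlus t"
  by (simp add: less_dreal_def)

text \<open>No decorated real lies strictly between $t^-$ and $t^+$.\<close>

lemma DPlus_le_iff: "DPlus t \<le> x \<longleftrightarrow> \<not> x \<le> DMinus t"
  by (cases x) auto

lemma dshift_le_iff: "dshift x e \<le> y \<longleftrightarrow> x \<le> dshift y (- e)"
  by (cases x; cases y) auto

lemma dshift_dshift: "dshift (dshift x a) b = dshift x (a + b)"
  by (cases x) auto

lemma dshift_0 [simp]: "dshift x 0 = x"
  by (cases x) auto

lemma dshift_mono: "x \<le> y \<Longrightarrow> dshift x e \<le> dshift y e"
  by (cases x; cases y) auto

lemma dinterval_subset_iff:
  assumes "b < d"
  shows "dinterval b d \<subseteq> dinterval b' d' \<longleftrightarrow> b' \<le> b \<and> d \<le> d'"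
proof
  assume sub: "dinterval b d \<subseteq> dinterval b' d'"
  show "b' \<le> b \<and> d \<le> d'"
  proof (rule ccontr)
    assume "\<not> ?thesis"
    then consider "b < b'" | "d' < d" by force
    then show False
    proof cases
      case 1
      \<comment> \<open>The bound \<open>min b' d\<close> puts the witness to the left of
        \<open>b'\<close> while keeping it inside \<open>dinterval b d\<close>.\<close>
      with assms obtain t where t: "b \<le> DMinus t" "DPlus t \<le> min b' d"
        using dinterval_ex[of b "min b' d"] by auto
      then have "t \<in> dinterval b d" by (simp add: mem_dinterval)
      with sub t show False by (auto simp: mem_dinterval DPlus_le_iff)
    next
      case 2
      with assms obtain t where t: "max b d' \<le> DMinus t" "DPlus t \<le> d"
        using dinterval_ex[of "max b d'" d] by auto
      then have "t \<in> dinterval b d" by (simp add: mem_dinterval)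
      with sub t show False by (auto simp: mem_dinterval DPlus_le_iff)
    qed
  qed
qed (auto simp: mem_dinterval)

text \<open>In this form the four inequalities split into two pairs, one for each direction. Each
  pair is what a nonzero matrix entry of a morphism into the shifted module forces, see
  \<open>shifted_morphism_matrix\<close>.\<close>

lemma close_intervals_iff:
  assumes "b < d" "b' < d'"
  shows "close_intervals \<epsilon> (dinterval b d) (dinterval b' d') \<longleftrightarrow>
    b' \<le> dshift b \<epsilon> \<and> d' \<le> dshift d \<epsilon> \<and> b \<le> dshift b' \<epsilon> \<and> d \<le> dshift d' \<epsilon>"
proof -
  have "close_intervals \<epsilon> (dinterval b d) (dinterval b' d') \<longleftrightarrow>
      dinterval b d \<subseteq> dinterval (dshift b' (- \<epsilon>)) (dshift d' \<epsilon>) \<and>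
      dinterval b' d' \<subseteq> dinterval (dshift b (- \<epsilon>)) (dshift d \<epsilon>)" (is "_ \<longleftrightarrow> ?r")
  proof
    assume "close_intervals \<epsilon> (dinterval b d) (dinterval b' d')"
    then show ?r
      unfolding close_intervals_def using dinterval_unique assms
      by (metis dinterval_nonempty_iff)
  next
    assume ?r
    then show "close_intervals \<epsilon> (dinterval b d) (dinterval b' d')"
      unfolding close_intervals_def using assms by (metis less_imp_le)
  qed
  then show ?thesis
    using assms by (auto simp: dinterval_subset_iff dshift_le_iff)
qed

lemma contains_closed_iff:
  assumes "\<epsilon> \<ge> 0"
  shows "(\<exists>a. {a..a + 2 * \<epsilon>} \<subseteq> dinterval b d) \<longleftrightarrow> dshift b (2 * \<epsilon>) < d"
proof
  assume "\<exists>a. {a..a + 2 * \<epsilon>} \<subseteq> dinterval b d"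
  then obtain a where "{a..a + 2 * \<epsilon>} \<subseteq> dinterval b d" by blast
  with assms have "a \<in> dinterval b d" "a + 2 * \<epsilon> \<in> dinterval b d" by auto
  then have "a + 2 * \<epsilon> \<in> dinterval (dshift b (2 * \<epsilon>)) d"
    using dshift_mono[of b "DMinus a" "2 * \<epsilon>"] by (simp add: mem_dinterval)
  then show "dshift b (2 * \<epsilon>) < d" by (rule dinterval_less)
next
  assume "dshift b (2 * \<epsilon>) < d"
  then obtain u where u: "dshift b (2 * \<epsilon>) \<le> DMinus u" "DPlus u \<le> d"
    using dinterval_ex by blast
  have "t \<in> dinterval b d" if "t \<in> {u - 2 * \<epsilon>..u}" for t
  proof -
    have "b \<le> DMinus t" using u(1) that by (cases b) auto
    moreover have "DPlus t \<le> d" using u(2) that by (cases d) auto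
    ultimately show ?thesis by (simp add: mem_dinterval)
  qed
  then have "{u - 2 * \<epsilon>..(u - 2 * \<epsilon>) + 2 * \<epsilon>} \<subseteq> dinterval b d" by auto
  then show "\<exists>a. {a..a + 2 * \<epsilon>} \<subseteq> dinterval b d" by blast
qed

text \<open>Polynomials, ordered by the sign of the leading coefficient, form an ordered ring in which
  the constant 1 is infinitesimal compared to \<open>X\<close>, and \<open>X\<close> compared to \<open>X\<^sup>2\<close>. Encoding
  $t^\pm$ as $tX \pm 1$ and $\pm\infty$ as $\pm X^2$ allows endpoints of intervals to be added,
  which gives a meaning to the midpoint of an arbitrary interval.\<close>

fun dpoly :: "dreal \<Rightarrow> real poly" where
  "dpoly DBot = [:0, 0, - 1:]"
| "dpoly (DMinus t) = [:- 1, t:]"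
| "dpoly (DPlus t) = [:1, t:]"
| "dpoly DTop = [:0, 0, 1:]"

lemma le_dshift_iff_dpoly:
  assumes "\<epsilon> \<ge> 0"
  shows "x \<le> dshift y \<epsilon> \<longleftrightarrow> dpoly x \<le> dpoly y + [:0, \<epsilon>:]"
  using assms by (cases x; cases y) (auto simp: less_eq_poly_def pos_poly_pCons)

text \<open>If there are nonzero morphisms $I \to J_{\_+\varepsilon}$ and
  $J \to I''_{\_+\varepsilon}$ and the midpoint of \<open>I\<close> is at most the one of \<open>I''\<close>,
  then \<open>J\<close> is close to one of the two.\<close>

lemma close_to_one:
  assumes "\<epsilon> \<ge> 0"
    and "b' \<le> dshift b \<epsilon>" "d' \<le> dshift d \<epsilon>" "b'' \<le> dshift b' \<epsilon>" "d'' \<le> dshift d' \<epsilon>"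
    and "dpoly b + dpoly d \<le> dpoly b'' + dpoly d''"
  shows "b \<le> dshift b' \<epsilon> \<and> d \<le> dshift d' \<epsilon> \<or> b' \<le> dshift b'' \<epsilon> \<and> d' \<le> dshift d'' \<epsilon>"
  using assms(2-) unfolding le_dshift_iff_dpoly[OF assms(1)] by linarith

text \<open>Otherwise \<open>d''\<close> would be at most \<open>dshift b (2 * \<epsilon>)\<close>,
  and the two length conditions would place \<open>b''\<close> below \<open>b\<close> and
  \<open>d''\<close> below \<open>d\<close>, against the order of the midpoints.\<close>

lemma overlap:
  assumes "\<epsilon> \<ge> 0"
    and "dshift b (2 * \<epsilon>) < d" "dshift b'' (2 * \<epsilon>) < d''"
    and "dpoly b + dpoly d \<le> dpoly b'' + dpoly d''"
  shows "dshift b (2 * \<epsilon>) < d''"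
proof -
  have "2 * \<epsilon> \<ge> 0" using assms(1) by simp
  then show ?thesis
    using assms(2-) unfolding not_le[symmetric] le_dshift_iff_dpoly[OF \<open>2 * \<epsilon> \<ge> 0\<close>]
    by linarith
qed

section \<open>Linear algebra over a field record\<close>

text \<open>Gaussian elimination by induction on the set of equations: an equation with a nonzero
  coefficient is used to eliminate one unknown, and a zero equation is dropped.\<close>

lemma (in field) homogeneous_system_nontrivial_solution:
  assumes "finite J" "finite A" "card J < card A"
    and "\<And>j i. j \<in> J \<Longrightarrow> i \<in> A \<Longrightarrow> p j i \<in> carrier R"
  shows "\<exists>c. (\<forall>i\<in>A. c i \<in> carrier R) \<and> (\<exists>i\<in>A. c i \<noteq> \<zero>) \<and>
    (\<forall>j\<in>J. (\<Oplus>i\<in>A. p j i \<otimes> c i) = \<zero>)"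
  using assms
proof (induction J arbitrary: A p rule: finite_induct)
  case empty
  then have "A \<noteq> {}" by auto
  then show ?case by (intro exI[of _ "\<lambda>_. \<one>"]) auto
next
  case (insert j J)
  note p = insert.prems(3)
  show ?case
  proof (cases "\<forall>i\<in>A. p j i = \<zero>")
    case True
    have "\<exists>c. (\<forall>i\<in>A. c i \<in> carrier R) \<and> (\<exists>i\<in>A. c i \<noteq> \<zero>) \<and>
        (\<forall>j\<in>J. (\<Oplus>i\<in>A. p j i \<otimes> c i) = \<zero>)"
      using insert.prems insert.hyps by (intro insert.IH) auto
    then obtain c where c: "\<forall>i\<in>A. c i \<in> carrier R" "\<exists>i\<in>A. c i \<noteq> \<zero>"
      "\<forall>j\<in>J. (\<Oplus>i\<in>A. p j i \<otimes> c i) = \<zero>" by blast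
    have "(\<Oplus>i\<in>A. p j i \<otimes> c i) = \<zero>"
      using True c(1) by (intro add.finprod_one_eqI) simp
    with c show ?thesis by (intro exI[of _ c]) simp
  next
    case False
    then obtain i0 where i0: "i0 \<in> A" "p j i0 \<noteq> \<zero>" by blast
    have pj0: "p j i0 \<in> carrier R" using p i0 by simp
    have unit: "p j i0 \<in> Units R" using pj0 i0(2) field_Units by blast
    have inv: "inv (p j i0) \<in> carrier R" "p j i0 \<otimes> inv (p j i0) = \<one>"
      using unit by (auto intro: Units_inv_closed Units_r_inv)
    define A' where "A' = A - {i0}"
    have A': "A = insert i0 A'" "i0 \<notin> A'" "finite A'"
      using i0 insert.prems(1) by (auto simp: A'_def)
    \<comment> \<open>Adding \<open>m k\<close> times equation \<open>j\<close> to equation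
      \<open>k\<close> cancels the coefficient of the unknown \<open>i0\<close>; \<open>q k\<close>
      below is the resulting row on the remaining unknowns.\<close>
    define m where "m k = \<ominus> (p k i0 \<otimes> inv (p j i0))" for k
    have m: "m k \<in> carrier R" if "k \<in> insert j J" for k
      using p[OF that i0(1)] inv by (simp add: m_def)
    define q where "q k i = p k i \<oplus> m k \<otimes> p j i" for k i
    have "card J < card A'"
      using insert.prems(2) insert.hyps A' by simp
    then have "\<exists>c. (\<forall>i\<in>A'. c i \<in> carrier R) \<and> (\<exists>i\<in>A'. c i \<noteq> \<zero>) \<and>
        (\<forall>k\<in>J. (\<Oplus>i\<in>A'. q k i \<otimes> c i) = \<zero>)"
      using p m A' by (intro insert.IH) (auto simp: q_def)
    then obtain c where c: "\<And>i. i \<in> A' \<Longrightarrow> c i \<in> carrier R" "\<exists>i\<in>A'. c i \<noteq> \<zero>"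
      "\<forall>k\<in>J. (\<Oplus>i\<in>A'. q k i \<otimes> c i) = \<zero>" by blast
    define s where "s k = (\<Oplus>i\<in>A'. p k i \<otimes> c i)" for k
    have pA': "p k i \<in> carrier R" if "k \<in> insert j J" "i \<in> A'" for k i
      using p that A' by simp
    have s: "s k \<in> carrier R" if "k \<in> insert j J" for k
      unfolding s_def using pA' that c by (intro finsum_closed) auto
    \<comment> \<open>Back substitution: the value at \<open>i0\<close> is the one that solves
      equation \<open>j\<close>.\<close>
    define c' where "c' = c(i0 := \<ominus> (inv (p j i0) \<otimes> s j))"
    have c'0: "c' i0 \<in> carrier R" using inv s by (simp add: c'_def)
    have row: "(\<Oplus>i\<in>A. p k i \<otimes> c' i) = p k i0 \<otimes> c' i0 \<oplus> s k" if k: "k \<in> insert j J" for k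
    proof -
      have "(\<Oplus>i\<in>A. p k i \<otimes> c' i) = p k i0 \<otimes> c' i0 \<oplus> (\<Oplus>i\<in>A'. p k i \<otimes> c' i)"
        using A' p[OF k i0(1)] c'0 pA'[OF k] c by (auto simp: c'_def)
      also have "(\<Oplus>i\<in>A'. p k i \<otimes> c' i) = s k"
        unfolding s_def using A'(2) pA'[OF k] c by (intro finsum_cong') (auto simp: c'_def)
      finally show ?thesis .
    qed
    have prod: "p k i0 \<otimes> c' i0 = m k \<otimes> s j" if k: "k \<in> insert j J" for k
      using p[OF k i0(1)] inv(1) s[of j] by (simp add: c'_def m_def l_minus r_minus m_assoc)
    have "(\<Oplus>i\<in>A. p k i \<otimes> c' i) = \<zero>" if k: "k \<in> insert j J" for k
    proof (cases "k = j")
      case True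
      have "m j = \<ominus> \<one>" using inv by (simp add: m_def)
      then show ?thesis
        using row[OF k] prod[OF k] s[of j] True by (simp add: l_minus l_neg)
    next
      case False
      then have kJ: "k \<in> J" using k by simp
      have "\<zero> = (\<Oplus>i\<in>A'. q k i \<otimes> c i)" using c(3) kJ by simp
      also have "\<dots> = (\<Oplus>i\<in>A'. p k i \<otimes> c i \<oplus> m k \<otimes> (p j i \<otimes> c i))"
        using pA' m c kJ by (intro finsum_cong') (auto simp: q_def l_distr m_assoc)
      also have "\<dots> = s k \<oplus> (\<Oplus>i\<in>A'. m k \<otimes> (p j i \<otimes> c i))"
        unfolding s_def using pA' m c kJ by (intro finsum_addf) auto
      also have "(\<Oplus>i\<in>A'. m k \<otimes> (p j i \<otimes> c i)) = m k \<otimes> s j"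
        unfolding s_def using pA' m c kJ A' by (intro finsum_rdistr[symmetric]) auto
      finally show ?thesis
        using row[OF k] prod[OF k] s[OF k] s[of j] m[OF k] by (simp add: a_comm)
    qed
    moreover have "\<forall>i\<in>A. c' i \<in> carrier R" using A' c c'0 by (auto simp: c'_def)
    moreover have "\<exists>i\<in>A. c' i \<noteq> \<zero>" using A' c(2) by (auto simp: c'_def)
    ultimately show ?thesis by blast
  qed
qed

lemma (in semiring) finsum_swap:
  assumes "finite A" "finite B" "\<And>i j. i \<in> A \<Longrightarrow> j \<in> B \<Longrightarrow> f i j \<in> carrier R"
  shows "(\<Oplus>i\<in>A. \<Oplus>j\<in>B. f i j) = (\<Oplus>j\<in>B. \<Oplus>i\<in>A. f i j)"
  using assms(1,3)
proof (induction A rule: finite_induct)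
  case (insert a A)
  have "(\<Oplus>i\<in>insert a A. \<Oplus>j\<in>B. f i j) = (\<Oplus>j\<in>B. f a j) \<oplus> (\<Oplus>i\<in>A. \<Oplus>j\<in>B. f i j)"
    using insert by (intro finsum_insert) (auto intro!: finsum_closed)
  also have "\<dots> = (\<Oplus>j\<in>B. f a j) \<oplus> (\<Oplus>j\<in>B. \<Oplus>i\<in>A. f i j)"
    using insert by simp
  also have "\<dots> = (\<Oplus>j\<in>B. f a j \<oplus> (\<Oplus>i\<in>A. f i j))"
    using insert by (intro finsum_addf[symmetric]) (auto intro!: finsum_closed)
  also have "\<dots> = (\<Oplus>j\<in>B. \<Oplus>i\<in>insert a A. f i j)"
    using insert by (intro finsum_cong') (auto intro!: finsum_closed finsum_insert[symmetric])
  finally show ?case .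
qed simp

text \<open>The hypothesis says that the product of the matrices \<^term>\<open>q\<close> and \<^term>\<open>p\<close> is
  unitriangular if \<^term>\<open>A\<close> is sorted by \<^term>\<open>key\<close>.\<close>

lemma (in field) card_le_if_unitriangular_product:
  fixes key :: "'i \<Rightarrow> 'k::linorder"
  assumes "finite A" "finite J"
    and p: "\<And>j i. j \<in> J \<Longrightarrow> i \<in> A \<Longrightarrow> p j i \<in> carrier R"
    and q: "\<And>j i. j \<in> J \<Longrightarrow> i \<in> A \<Longrightarrow> q i j \<in> carrier R"
    and tri: "\<And>i i'. i \<in> A \<Longrightarrow> i' \<in> A \<Longrightarrow> key i \<le> key i' \<Longrightarrow>
      (\<Oplus>j\<in>J. q i' j \<otimes> p j i) = (if i = i' then \<one> else \<zero>)"
  shows "card A \<le> card J"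
proof (rule ccontr)
  assume "\<not> card A \<le> card J"
  then have "card J < card A" by simp
  then have "\<exists>c. (\<forall>i\<in>A. c i \<in> carrier R) \<and> (\<exists>i\<in>A. c i \<noteq> \<zero>) \<and>
      (\<forall>j\<in>J. (\<Oplus>i\<in>A. p j i \<otimes> c i) = \<zero>)"
    by (rule homogeneous_system_nontrivial_solution[OF assms(2,1) _ p])
  then obtain c where c: "\<And>i. i \<in> A \<Longrightarrow> c i \<in> carrier R" "\<exists>i\<in>A. c i \<noteq> \<zero>"
    "\<And>j. j \<in> J \<Longrightarrow> (\<Oplus>i\<in>A. p j i \<otimes> c i) = \<zero>" by auto
  \<comment> \<open>In the support \<open>S\<close> of the solution, \<open>a\<close> is chosen with
    the largest key. Combining the equations with the coefficients \<open>q a j\<close> then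
    involves, on the support, only products with \<open>key i \<le> key a\<close>, which
    \<open>tri\<close> evaluates. What remains is \<open>c a\<close>, which must therefore
    vanish.\<close>
  define S where "S = {i \<in> A. c i \<noteq> \<zero>}"
  have S: "finite S" "S \<noteq> {}" using c(2) assms(1) by (auto simp: S_def)
  then have "Max (key ` S) \<in> key ` S" by (intro Max_in) auto
  then obtain a where a: "a \<in> S" "key a = Max (key ` S)" by auto
  then have le: "key i \<le> key a" if "i \<in> S" for i using S that by simp
  have aA: "a \<in> A" "c a \<noteq> \<zero>" using a by (auto simp: S_def)
  have "\<zero> = (\<Oplus>j\<in>J. q a j \<otimes> (\<Oplus>i\<in>A. p j i \<otimes> c i))"
    using c(3) q aA by (intro add.finprod_one_eqI[symmetric]) simp
  also have "\<dots> = (\<Oplus>j\<in>J. \<Oplus>i\<in>A. q a j \<otimes> (p j i \<otimes> c i))"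
    using c p q aA assms(1) by (intro finsum_cong' finsum_rdistr) (auto intro!: finsum_closed)
  also have "\<dots> = (\<Oplus>i\<in>A. \<Oplus>j\<in>J. q a j \<otimes> (p j i \<otimes> c i))"
    using c p q aA assms(1,2) by (intro finsum_swap) auto
  also have "\<dots> = (\<Oplus>i\<in>A. if a = i then c i else \<zero>)"
  proof (rule finsum_cong')
    fix i assume i: "i \<in> A"
    have "(\<Oplus>j\<in>J. q a j \<otimes> (p j i \<otimes> c i)) = (\<Oplus>j\<in>J. (q a j \<otimes> p j i) \<otimes> c i)"
      using c p q aA i by (intro finsum_cong') (auto simp: m_assoc)
    also have "\<dots> = (\<Oplus>j\<in>J. q a j \<otimes> p j i) \<otimes> c i"
      using c p q aA i assms(2) by (intro finsum_ldistr[symmetric]) auto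
    also have "\<dots> = (if a = i then c i else \<zero>)"
    proof (cases "i \<in> S")
      case True
      then show ?thesis using tri[OF i aA(1) le] c(1)[OF i] by auto
    next
      case False
      then have "c i = \<zero>" using i by (simp add: S_def)
      moreover have "(\<Oplus>j\<in>J. q a j \<otimes> p j i) \<in> carrier R"
        using p q aA i by (intro finsum_closed) auto
      ultimately show ?thesis by simp
    qed
    finally show "(\<Oplus>j\<in>J. q a j \<otimes> (p j i \<otimes> c i)) = (if a = i then c i else \<zero>)" .
  qed (use c in auto)
  also have "\<dots> = c a"
    using finsum_singleton[of a A c] aA(1) assms(1) c(1) by auto
  finally show False using aA by simp
qed

section \<open>Direct sums of interval modules\<close>

abbreviation interval_sum ::
    "('a, 'm) ring_scheme \<Rightarrow> 'i set \<Rightarrow> ('i \<Rightarrow> real set) \<Rightarrow> ('a, 'i \<Rightarrow> 'a) pmod" where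
  "interval_sum F I L \<equiv> direct_sum I (\<lambda>i. interval_module F (L i))"

lemma interval_sum_carrier:
  "carrier (vspace (interval_sum F I L) t) =
    (\<Pi>\<^sub>E i\<in>I. if t \<in> L i then carrier F else {\<zero>\<^bsub>F\<^esub>})"
  by (simp add: direct_sum_def interval_module_def)

lemma interval_sum_add:
  "x \<oplus>\<^bsub>vspace (interval_sum F I L) t\<^esub> y = (\<lambda>i\<in>I. x i \<oplus>\<^bsub>F\<^esub> y i)"
  by (simp add: direct_sum_def interval_module_def)

lemma interval_sum_smult:
  "a \<odot>\<^bsub>vspace (interval_sum F I L) t\<^esub> x = (\<lambda>i\<in>I. a \<otimes>\<^bsub>F\<^esub> x i)"
  by (simp add: direct_sum_def interval_module_def)

lemma interval_sum_smap:
  "smap (interval_sum F I L) s t x = (\<lambda>i\<in>I. if s \<in> L i \<and> t \<in> L i then x i else \<zero>\<^bsub>F\<^esub>)"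
  by (simp add: direct_sum_def interval_module_def)

section \<open>Linear maps between sums of interval modules in coordinates\<close>

lemma linear_mapsI:
  assumes "\<And>x. x \<in> carrier M \<Longrightarrow> f x \<in> carrier N"
    and "\<And>x y. x \<in> carrier M \<Longrightarrow> y \<in> carrier M \<Longrightarrow> f (x \<oplus>\<^bsub>M\<^esub> y) = f x \<oplus>\<^bsub>N\<^esub> f y"
    and "\<And>a x. a \<in> carrier F \<Longrightarrow> x \<in> carrier M \<Longrightarrow> f (a \<odot>\<^bsub>M\<^esub> x) = a \<odot>\<^bsub>N\<^esub> f x"
  shows "f \<in> linear_maps F M N"
  using assms by (auto simp: linear_maps_def hom_def)

lemma linear_mapsD:
  assumes "f \<in> linear_maps F M N"
  shows "x \<in> carrier M \<Longrightarrow> f x \<in> carrier N"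
    and "x \<in> carrier M \<Longrightarrow> y \<in> carrier M \<Longrightarrow> f (x \<oplus>\<^bsub>M\<^esub> y) = f x \<oplus>\<^bsub>N\<^esub> f y"
    and "a \<in> carrier F \<Longrightarrow> x \<in> carrier M \<Longrightarrow> f (a \<odot>\<^bsub>M\<^esub> x) = a \<odot>\<^bsub>N\<^esub> f x"
  using assms by (auto simp: linear_maps_def hom_def)

lemma linear_maps_comp:
  assumes "f \<in> linear_maps F M N" "g \<in> linear_maps F N P"
  shows "(\<lambda>x. g (f x)) \<in> linear_maps F M P"
  using linear_mapsD[OF assms(1)] linear_mapsD[OF assms(2)] by (intro linear_mapsI) auto

text \<open>One function serves as the basis vector of summand \<open>i\<close> at every
  \<open>t\<close> in \<open>L i\<close>, so that structure maps fix it for as long as the bar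
  lives.\<close>

definition unit_vec :: "('a, 'm) ring_scheme \<Rightarrow> 'i set \<Rightarrow> 'i \<Rightarrow> 'i \<Rightarrow> 'a" where
  "unit_vec F I i = (\<lambda>k\<in>I. if k = i then \<one>\<^bsub>F\<^esub> else \<zero>\<^bsub>F\<^esub>)"

lemma unit_vec_carrier:
  assumes "field F" "t \<in> L i"
  shows "unit_vec F I i \<in> carrier (vspace (interval_sum F I L) t)"
proof -
  interpret field F by fact
  show ?thesis using assms(2) by (auto simp: unit_vec_def interval_sum_carrier)
qed

lemma linear_map_zero:
  assumes "field F" "f \<in> linear_maps F (vspace (interval_sum F J L) t) (vspace (interval_sum F I L') u)"
  shows "f (\<lambda>j\<in>J. \<zero>\<^bsub>F\<^esub>) = (\<lambda>i\<in>I. \<zero>\<^bsub>F\<^esub>)"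
proof -
  interpret field F by fact
  have z: "(\<lambda>j\<in>J. \<zero>\<^bsub>F\<^esub>) \<in> carrier (vspace (interval_sum F J L) t)"
    by (auto simp: interval_sum_carrier)
  let ?z = "\<lambda>j\<in>J. \<zero>\<^bsub>F\<^esub>"
  have fz: "f ?z i \<in> carrier F" if "i \<in> I" for i
    using linear_mapsD(1)[OF assms(2) z] that
    by (auto simp: interval_sum_carrier PiE_iff split: if_splits)
  \<comment> \<open>Linearity is stated for sums and scalar multiples only, so zero is treated as a
    multiple of itself by the scalar zero.\<close>
  have "f ?z = f (\<zero>\<^bsub>F\<^esub> \<odot>\<^bsub>vspace (interval_sum F J L) t\<^esub> ?z)"
    by (simp add: interval_sum_smult cong: restrict_cong)
  also have "\<dots> = (\<lambda>i\<in>I. \<zero>\<^bsub>F\<^esub> \<otimes>\<^bsub>F\<^esub> f ?z i)"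
    using linear_mapsD(3)[OF assms(2) zero_closed z] by (simp only: interval_sum_smult)
  also have "\<dots> = (\<lambda>i\<in>I. \<zero>\<^bsub>F\<^esub>)"
    using fz by (intro restrict_ext) simp
  finally show ?thesis .
qed

text \<open>The sum runs over the bars alive at \<open>t\<close> only: the unit vectors of the other
  bars are not in the space at \<open>t\<close>, and there \<open>f\<close> may take arbitrary
  values.\<close>

lemma linear_map_expansion:
  assumes "field F" "finite J"
    and f: "f \<in> linear_maps F (vspace (interval_sum F J L) t) (vspace (interval_sum F I L') u)"
    and y: "y \<in> carrier (vspace (interval_sum F J L) t)" and "i \<in> I"
  shows "f y i = (\<Oplus>\<^bsub>F\<^esub>j\<in>{j \<in> J. t \<in> L j}. y j \<otimes>\<^bsub>F\<^esub> f (unit_vec F J j) i)"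
proof -
  interpret field F by fact
  let ?C = "carrier (vspace (interval_sum F J L) t)"
  \<comment> \<open>The vector \<open>z K\<close> is \<open>y\<close> cut down to the coordinates in
    \<open>K\<close>; the induction restores one coordinate at a time.\<close>
  define z where "z K = (\<lambda>k\<in>J. if k \<in> K then y k else \<zero>\<^bsub>F\<^esub>)" for K
  have yk: "y k \<in> carrier F" if "k \<in> J" for k
    using y that by (auto simp: interval_sum_carrier PiE_iff split: if_splits)
  have zC: "z K \<in> ?C" for K
    using y by (auto simp: z_def interval_sum_carrier PiE_iff)
  have fu: "f x i \<in> carrier F" if "x \<in> ?C" for x
    using linear_mapsD(1)[OF f that] \<open>i \<in> I\<close>
    by (auto simp: interval_sum_carrier PiE_iff split: if_splits)
  have expand: "f (z K) i = (\<Oplus>\<^bsub>F\<^esub>j\<in>K. y j \<otimes>\<^bsub>F\<^esub> f (unit_vec F J j) i)"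
    if "finite K" "K \<subseteq> {j \<in> J. t \<in> L j}" for K
    using that
  proof (induction K rule: finite_induct)
    case empty
    have "z {} = (\<lambda>j\<in>J. \<zero>\<^bsub>F\<^esub>)" by (simp add: z_def)
    then have "f (z {}) i = \<zero>\<^bsub>F\<^esub>"
      using \<open>i \<in> I\<close> by (simp only: linear_map_zero[OF assms(1) f] restrict_apply if_True)
    then show ?case by simp
  next
    case (insert j K)
    then have j: "j \<in> J" "t \<in> L j" by auto
    let ?e = "unit_vec F J j"
    have e: "?e \<in> ?C" by (rule unit_vec_carrier) (use assms(1) j in auto)
    have ye: "y j \<odot>\<^bsub>vspace (interval_sum F J L) t\<^esub> ?e \<in> ?C"
      using j yk by (auto simp: interval_sum_smult interval_sum_carrier unit_vec_def)
    have "z (insert j K) = z K \<oplus>\<^bsub>vspace (interval_sum F J L) t\<^esub>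
        (y j \<odot>\<^bsub>vspace (interval_sum F J L) t\<^esub> ?e)"
      using insert.hyps yk j(1)
      by (auto simp: interval_sum_smult interval_sum_add z_def unit_vec_def intro!: restrict_ext)
    then have "f (z (insert j K)) i = f (z K) i \<oplus>\<^bsub>F\<^esub> y j \<otimes>\<^bsub>F\<^esub> f ?e i"
      using linear_mapsD(2)[OF f zC[of K] ye] linear_mapsD(3)[OF f yk[OF j(1)] e] \<open>i \<in> I\<close>
      by (simp add: interval_sum_add interval_sum_smult)
    also have "\<dots> = y j \<otimes>\<^bsub>F\<^esub> f ?e i \<oplus>\<^bsub>F\<^esub> f (z K) i"
      using fu e zC yk j by (intro a_comm) auto
    also have "f (z K) i = (\<Oplus>\<^bsub>F\<^esub>j\<in>K. y j \<otimes>\<^bsub>F\<^esub> f (unit_vec F J j) i)"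
      using insert by auto
    also have "y j \<otimes>\<^bsub>F\<^esub> f ?e i \<oplus>\<^bsub>F\<^esub> \<dots> =
        (\<Oplus>\<^bsub>F\<^esub>j\<in>insert j K. y j \<otimes>\<^bsub>F\<^esub> f (unit_vec F J j) i)"
    proof (rule finsum_insert[symmetric])
      have "y k \<otimes>\<^bsub>F\<^esub> f (unit_vec F J k) i \<in> carrier F" if "k \<in> insert j K" for k
        using fu[OF unit_vec_carrier[OF assms(1), where L = L]] yk insert.prems that by auto
      then show "(\<lambda>j. y j \<otimes>\<^bsub>F\<^esub> f (unit_vec F J j) i) \<in> K \<rightarrow> carrier F"
        "y j \<otimes>\<^bsub>F\<^esub> f ?e i \<in> carrier F" by auto
    qed (use insert.hyps in auto)
    finally show ?case .
  qed
  have "z {j \<in> J. t \<in> L j} = y"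
    using y by (auto simp: z_def interval_sum_carrier PiE_iff fun_eq_iff extensional_def)
  then show ?thesis using expand[of "{j \<in> J. t \<in> L j}"] assms(2) by simp
qed

section \<open>Matrices of morphisms into shifted modules, and Hall's condition\<close>

lemma pshift_simps [simp]:
  "vspace (pshift \<epsilon> V) t = vspace V (t + \<epsilon>)"
  "smap (pshift \<epsilon> V) s t = smap V (s + \<epsilon>) (t + \<epsilon>)"
  by (simp_all add: pshift_def)

text \<open>By naturality an entry does not depend on \<open>t\<close> while both bars are alive. If
  the bar of \<open>j\<close> began or ended later than the bar of \<open>i\<close> moved by
  \<epsilon>, one path around a naturality square would pass through zero and the entry would
  vanish.\<close>

lemma shifted_morphism_matrix:
  assumes "field F"
    and L: "\<And>i. i \<in> I \<Longrightarrow> L i = dinterval (b i) (d i)"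
    and L': "\<And>j. j \<in> J \<Longrightarrow> L' j = dinterval (b' j) (d' j)"
    and mor: "pmorphism F (interval_sum F I L) (pshift \<epsilon> (interval_sum F J L')) \<phi>"
  obtains c where "\<And>i j. i \<in> I \<Longrightarrow> j \<in> J \<Longrightarrow> c j i \<in> carrier F"
    and "\<And>i j t. i \<in> I \<Longrightarrow> j \<in> J \<Longrightarrow> t \<in> L i \<Longrightarrow> t + \<epsilon> \<in> L' j \<Longrightarrow>
      \<phi> t (unit_vec F I i) j = c j i"
    and "\<And>i j. i \<in> I \<Longrightarrow> j \<in> J \<Longrightarrow> c j i \<noteq> \<zero>\<^bsub>F\<^esub> \<Longrightarrow>
      b' j \<le> dshift (b i) \<epsilon> \<and> d' j \<le> dshift (d i) \<epsilon>"
proof -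
  interpret field F by fact
  let ?U = "interval_sum F I L" and ?V = "interval_sum F J L'"
  define P where "P i j t \<longleftrightarrow> t \<in> L i \<and> t + \<epsilon> \<in> L' j" for i j t
  \<comment> \<open>The default value serves pairs of bars that are never alive together at shift
    \<epsilon>. For all others the choice of the point is immaterial by \<open>const\<close>
    below.\<close>
  define c where
    "c j i = (if \<exists>t. P i j t then \<phi> (SOME t. P i j t) (unit_vec F I i) j else \<zero>\<^bsub>F\<^esub>)" for j i
  have lin: "\<phi> t \<in> linear_maps F (vspace ?U t) (vspace ?V (t + \<epsilon>))" for t
    using mor unfolding pmorphism_def pshift_simps by blast
  have nat: "\<phi> t (smap ?U s t x) = smap ?V (s + \<epsilon>) (t + \<epsilon>) (\<phi> s x)"
    if "s \<le> t" "x \<in> carrier (vspace ?U s)" for s t x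
    using mor that unfolding pmorphism_def pshift_simps by blast
  have val: "\<phi> t (unit_vec F I i) j \<in> carrier F" if "i \<in> I" "j \<in> J" "t \<in> L i" for i j t
    using linear_mapsD(1)[OF lin unit_vec_carrier[OF assms(1), where L = L, OF that(3)]] that(2)
    by (auto simp: interval_sum_carrier PiE_iff split: if_splits)
  have nat_unit: "(if t \<in> L i then \<phi> t (unit_vec F I i) j else \<zero>\<^bsub>F\<^esub>) =
      (if s + \<epsilon> \<in> L' j \<and> t + \<epsilon> \<in> L' j then \<phi> s (unit_vec F I i) j else \<zero>\<^bsub>F\<^esub>)"
    if "i \<in> I" "j \<in> J" "s \<in> L i" "s \<le> t" for i j s t
  proof -
    have "smap ?U s t (unit_vec F I i) =
        (if t \<in> L i then unit_vec F I i else (\<lambda>k\<in>I. \<zero>\<^bsub>F\<^esub>))"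
      using that(3) by (auto simp: interval_sum_smap unit_vec_def intro!: restrict_ext)
    moreover have "\<phi> t (\<lambda>k\<in>I. \<zero>\<^bsub>F\<^esub>) j = \<zero>\<^bsub>F\<^esub>"
      using that(2) by (simp only: linear_map_zero[OF assms(1) lin] restrict_apply if_True)
    ultimately have "(if t \<in> L i then \<phi> t (unit_vec F I i) j else \<zero>\<^bsub>F\<^esub>) =
        \<phi> t (smap ?U s t (unit_vec F I i)) j" by simp
    also have "\<dots> = smap ?V (s + \<epsilon>) (t + \<epsilon>) (\<phi> s (unit_vec F I i)) j"
      using nat[OF that(4) unit_vec_carrier[OF assms(1), where L = L, OF that(3)]] by simp
    finally show ?thesis using that(2) by (simp add: interval_sum_smap)
  qed
  have const: "\<phi> s (unit_vec F I i) j = \<phi> t (unit_vec F I i) j"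
    if ij: "i \<in> I" "j \<in> J" and st: "P i j s" "P i j t" for i j s t
    using nat_unit[OF ij, of s t] nat_unit[OF ij, of t s] st
    by (cases "s \<le> t") (auto simp: P_def)
  have some: "P i j (SOME t. P i j t)" if "P i j t" for i j t
    using that by (rule someI)
  show thesis
  proof (rule that)
    fix i j assume ij: "i \<in> I" "j \<in> J"
    show "c j i \<in> carrier F"
      using val[OF ij] some[of i j] by (auto simp: c_def P_def)
    show "\<phi> t (unit_vec F I i) j = c j i"
      if "t \<in> L i" "t + \<epsilon> \<in> L' j" for t
    proof -
      have "P i j t" using that by (simp add: P_def)
      then show ?thesis using const[OF ij _ some] by (auto simp: c_def)
    qed
    assume "c j i \<noteq> \<zero>\<^bsub>F\<^esub>"
    then obtain u where u: "P i j u" "\<phi> u (unit_vec F I i) j \<noteq> \<zero>\<^bsub>F\<^esub>"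
      using some[of i j] by (auto simp: c_def split: if_splits)
    have uL: "u \<in> L i" "b i \<le> DMinus u" "DPlus u \<le> d i"
      and uL': "u + \<epsilon> \<in> L' j" "b' j \<le> DMinus (u + \<epsilon>)" "DPlus (u + \<epsilon>) \<le> d' j"
      using u(1) ij by (auto simp: P_def L L' mem_dinterval)
    show "b' j \<le> dshift (b i) \<epsilon> \<and> d' j \<le> dshift (d i) \<epsilon>"
    proof
      show "b' j \<le> dshift (b i) \<epsilon>"
      proof (rule ccontr)
        assume "\<not> b' j \<le> dshift (b i) \<epsilon>"
        then have "dshift (b i) \<epsilon> < b' j" by (simp only: not_le)
        moreover have "dshift (b i) \<epsilon> < DPlus (u + \<epsilon>)"
          using dshift_mono[OF uL(2), of \<epsilon>] DMinus_less_DPlus[of "u + \<epsilon>"] by simp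
        \<comment> \<open>At \<open>v - \<epsilon>\<close> bar \<open>i\<close> is alive while bar
          \<open>j\<close> is not yet alive at \<open>v\<close>. Hence the value at the later point
          \<open>u\<close> is carried over from zero.\<close>
        ultimately obtain v where v: "dshift (b i) \<epsilon> \<le> DMinus v" "DPlus v \<le> b' j" "v \<le> u + \<epsilon>"
          using dinterval_ex[of "dshift (b i) \<epsilon>" "min (b' j) (DPlus (u + \<epsilon>))"] by auto
        have "b i \<le> DMinus (v - \<epsilon>)" using v(1) by (simp add: dshift_le_iff)
        moreover have "DPlus (v - \<epsilon>) \<le> d i"
          using uL(3) v(3) order_trans[of "DPlus (v - \<epsilon>)" "DPlus u" "d i"] by simp
        ultimately have "v - \<epsilon> \<in> L i" by (simp add: L[OF ij(1)] mem_dinterval)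
        moreover have "v \<notin> L' j" using v(2) by (auto simp: L'[OF ij(2)] mem_dinterval DPlus_le_iff)
        ultimately show False using nat_unit[OF ij, of "v - \<epsilon>" u] v(3) uL(1) u(2) by simp
      qed
      show "d' j \<le> dshift (d i) \<epsilon>"
      proof (rule ccontr)
        assume "\<not> d' j \<le> dshift (d i) \<epsilon>"
        then have "dshift (d i) \<epsilon> < d' j" by (simp only: not_le)
        moreover have "DMinus (u + \<epsilon>) < d' j"
          using uL'(3) DMinus_less_DPlus[of "u + \<epsilon>"] by simp
        \<comment> \<open>At \<open>v - \<epsilon>\<close> bar \<open>i\<close> has ended while bar
          \<open>j\<close> is still alive at \<open>v\<close>. The image of the unit vector survives
          although the vector itself has died.\<close>
        ultimately obtain v where v: "dshift (d i) \<epsilon> \<le> DMinus v" "DPlus v \<le> d' j" "u + \<epsilon> \<le> v"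
          using dinterval_ex[of "max (dshift (d i) \<epsilon>) (DMinus (u + \<epsilon>))" "d' j"] by auto
        have "d i \<le> DMinus (v - \<epsilon>)" using v(1) by (simp add: dshift_le_iff)
        then have "v - \<epsilon> \<notin> L i" by (auto simp: L[OF ij(1)] mem_dinterval DPlus_le_iff)
        moreover have "v \<in> L' j"
          using v uL'(2) order_trans[of "b' j" "DMinus (u + \<epsilon>)" "DMinus v"]
          by (simp add: L'[OF ij(2)] mem_dinterval)
        ultimately show False using nat_unit[OF ij, of u "v - \<epsilon>"] v(3) uL(1) uL'(1) u(2) by simp
      qed
    qed
  qed
qed

text \<open>A bar through which the entry $(i, i')$ of \<^term>\<open>\<psi> \<circ> \<phi>\<close> receives a nonzero contribution,
  where the midpoint of \<open>i\<close> is at most the one of \<open>i'\<close>, is close to \<open>i\<close> or \<open>i'\<close>. So if the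
  matrix of \<^term>\<open>\<psi> \<circ> \<phi>\<close> on \<^term>\<open>S\<close> is computed with only the bars in the neighbourhood of
  \<^term>\<open>S\<close>, it is still unitriangular.\<close>

lemma hall_condition:
  assumes "field F" "finite J" "\<epsilon> \<ge> 0"
    and L: "\<And>i. i \<in> I \<Longrightarrow> L i = dinterval (b i) (d i)"
    and L': "\<And>j. j \<in> J \<Longrightarrow> L' j = dinterval (b' j) (d' j)"
    and inter: "interleaving F \<epsilon> (interval_sum F I L) (interval_sum F J L') \<phi> \<psi>"
    and S: "finite S" "S \<subseteq> I" "\<And>i. i \<in> S \<Longrightarrow> dshift (b i) (2 * \<epsilon>) < d i"
  defines "R \<equiv> \<lambda>i. {j \<in> J. b' j \<le> dshift (b i) \<epsilon> \<and> d' j \<le> dshift (d i) \<epsilon> \<and>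
    b i \<le> dshift (b' j) \<epsilon> \<and> d i \<le> dshift (d' j) \<epsilon>}"
  shows "card S \<le> card (\<Union>i\<in>S. R i)"
proof -
  interpret field F by fact
  let ?U = "interval_sum F I L" and ?V = "interval_sum F J L'"
  have phi: "pmorphism F ?U (pshift \<epsilon> ?V) \<phi>" and psi: "pmorphism F ?V (pshift \<epsilon> ?U) \<psi>"
    and comp: "\<And>t x. x \<in> carrier (vspace ?U t) \<Longrightarrow> \<psi> (t + \<epsilon>) (\<phi> t x) = smap ?U t (t + 2 * \<epsilon>) x"
    using inter unfolding interleaving_def by blast+
  obtain p where p: "\<And>i j. i \<in> I \<Longrightarrow> j \<in> J \<Longrightarrow> p j i \<in> carrier F"
      "\<And>i j t. i \<in> I \<Longrightarrow> j \<in> J \<Longrightarrow> t \<in> L i \<Longrightarrow> t + \<epsilon> \<in> L' j \<Longrightarrow> \<phi> t (unit_vec F I i) j = p j i"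
      "\<And>i j. i \<in> I \<Longrightarrow> j \<in> J \<Longrightarrow> p j i \<noteq> \<zero>\<^bsub>F\<^esub> \<Longrightarrow>
        b' j \<le> dshift (b i) \<epsilon> \<and> d' j \<le> dshift (d i) \<epsilon>"
    using shifted_morphism_matrix[OF assms(1) L L' phi] by blast
  obtain q where q: "\<And>j i. j \<in> J \<Longrightarrow> i \<in> I \<Longrightarrow> q i j \<in> carrier F"
      "\<And>j i t. j \<in> J \<Longrightarrow> i \<in> I \<Longrightarrow> t \<in> L' j \<Longrightarrow> t + \<epsilon> \<in> L i \<Longrightarrow> \<psi> t (unit_vec F J j) i = q i j"
      "\<And>j i. j \<in> J \<Longrightarrow> i \<in> I \<Longrightarrow> q i j \<noteq> \<zero>\<^bsub>F\<^esub> \<Longrightarrow>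
        b i \<le> dshift (b' j) \<epsilon> \<and> d i \<le> dshift (d' j) \<epsilon>"
    using shifted_morphism_matrix[OF assms(1) L' L psi] by blast
  have pq: "q i' j \<otimes>\<^bsub>F\<^esub> p j i \<in> carrier F" if "i \<in> I" "i' \<in> I" "j \<in> J" for i i' j
    using p(1) q(1) that by simp
  have nz: "p j i \<noteq> \<zero>\<^bsub>F\<^esub> \<and> q i' j \<noteq> \<zero>\<^bsub>F\<^esub>"
    if "i \<in> I" "i' \<in> I" "j \<in> J" "q i' j \<otimes>\<^bsub>F\<^esub> p j i \<noteq> \<zero>\<^bsub>F\<^esub>" for i i' j
    using p(1) q(1) that by auto
  \<comment> \<open>A nonzero contribution to an entry between bars alive at \<open>t\<close> and
    \<open>t + 2 * \<epsilon>\<close> comes from a bar alive halfway. So the sum over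
    \<open>J\<close> equals the sum over the bars alive at \<open>t + \<epsilon>\<close>, which is
    what the composition of the morphisms computes.\<close>
  have mid: "j \<in> J \<and> t + \<epsilon> \<in> L' j"
    if "i \<in> I" "i' \<in> I" "j \<in> J" "q i' j \<otimes>\<^bsub>F\<^esub> p j i \<noteq> \<zero>\<^bsub>F\<^esub>" "t \<in> L i" "t + 2 * \<epsilon> \<in> L i'"
    for i i' j t
  proof -
    have "b' j \<le> dshift (b i) \<epsilon>" "d i' \<le> dshift (d' j) \<epsilon>"
      using p(3)[of i j] q(3)[of j i'] nz[OF that(1-4)] that(1-3) by auto
    moreover have "dshift (b i) \<epsilon> \<le> DMinus (t + \<epsilon>)"
      using that(5) dshift_mono[of "b i" "DMinus t" \<epsilon>] by (simp add: L[OF that(1)] mem_dinterval)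
    moreover have "DPlus (t + 2 * \<epsilon>) \<le> d i'"
      using that(6) by (simp add: L[OF that(2)] mem_dinterval)
    ultimately have "b' j \<le> DMinus (t + \<epsilon>)" "DPlus (t + 2 * \<epsilon>) \<le> dshift (d' j) \<epsilon>"
      by (auto intro: order_trans)
    moreover from this(2) have "DPlus (t + \<epsilon>) \<le> d' j" by (cases "d' j") auto
    ultimately show ?thesis using that(3) by (simp add: L'[OF that(3)] mem_dinterval)
  qed
  \<comment> \<open>The sum is an entry of the structure map from \<open>t\<close> to
    \<open>t + 2 * \<epsilon>\<close>, which is diagonal; both bars being alive at the respective
    ends makes the diagonal value one.\<close>
  have entry: "(\<Oplus>\<^bsub>F\<^esub>j\<in>J. q i' j \<otimes>\<^bsub>F\<^esub> p j i) = (if i = i' then \<one>\<^bsub>F\<^esub> else \<zero>\<^bsub>F\<^esub>)"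
    if i: "i \<in> I" "i' \<in> I" and t: "t \<in> L i" "t + 2 * \<epsilon> \<in> L i'" for i i' t
  proof -
    let ?e = "unit_vec F I i" and ?K = "{j \<in> J. t + \<epsilon> \<in> L' j}"
    have e: "?e \<in> carrier (vspace ?U t)" by (rule unit_vec_carrier) (use assms(1) t in auto)
    have lin: "\<phi> t \<in> linear_maps F (vspace ?U t) (vspace ?V (t + \<epsilon>))"
      "\<psi> (t + \<epsilon>) \<in> linear_maps F (vspace ?V (t + \<epsilon>)) (vspace ?U (t + \<epsilon> + \<epsilon>))"
      using phi psi unfolding pmorphism_def pshift_simps by blast+
    have "(\<Oplus>\<^bsub>F\<^esub>j\<in>J. q i' j \<otimes>\<^bsub>F\<^esub> p j i) = (\<Oplus>\<^bsub>F\<^esub>j\<in>?K. q i' j \<otimes>\<^bsub>F\<^esub> p j i)"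
      using mid[OF i _ _ t] pq[OF i] assms(2)
      by (intro add.finprod_mono_neutral_cong_right) auto
    also have "\<dots> = (\<Oplus>\<^bsub>F\<^esub>j\<in>?K. \<phi> t ?e j \<otimes>\<^bsub>F\<^esub> \<psi> (t + \<epsilon>) (unit_vec F J j) i')"
      using p(1) q(1) p(2)[of i _ t] q(2)[of _ i' "t + \<epsilon>"] i t
      by (intro finsum_cong') (auto simp: m_comm add.assoc)
    also have "\<dots> = \<psi> (t + \<epsilon>) (\<phi> t ?e) i'"
      using linear_map_expansion[OF assms(1,2) lin(2) linear_mapsD(1)[OF lin(1) e] i(2)] by simp
    also have "\<dots> = smap ?U t (t + 2 * \<epsilon>) ?e i'" using comp[OF e] by simp
    also have "\<dots> = (if i = i' then \<one>\<^bsub>F\<^esub> else \<zero>\<^bsub>F\<^esub>)"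
      using i t by (auto simp: interval_sum_smap unit_vec_def)
    finally show ?thesis .
  qed
  let ?key = "\<lambda>i. dpoly (b i) + dpoly (d i)"
  let ?N = "\<Union>i\<in>S. R i"
  have RJ: "?N \<subseteq> J" by (auto simp: R_def)
  have "(\<Oplus>\<^bsub>F\<^esub>j\<in>?N. q i' j \<otimes>\<^bsub>F\<^esub> p j i) = (if i = i' then \<one>\<^bsub>F\<^esub> else \<zero>\<^bsub>F\<^esub>)"
    if iS: "i \<in> S" "i' \<in> S" and key: "?key i \<le> ?key i'" for i i'
  proof -
    have i: "i \<in> I" "i' \<in> I" using iS S(2) by auto
    have ov: "dshift (b i) (2 * \<epsilon>) < d i'"
      by (rule overlap[OF assms(3) S(3)[OF iS(1)] S(3)[OF iS(2)] key])
    have "j \<in> ?N" if "j \<in> J" "q i' j \<otimes>\<^bsub>F\<^esub> p j i \<noteq> \<zero>\<^bsub>F\<^esub>" for j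
    proof -
      note * = p(3)[OF i(1) that(1)] q(3)[OF that(1) i(2)] nz[OF i that]
      then have "b i \<le> dshift (b' j) \<epsilon> \<and> d i \<le> dshift (d' j) \<epsilon> \<or>
          b' j \<le> dshift (b i') \<epsilon> \<and> d' j \<le> dshift (d i') \<epsilon>"
        using close_to_one[OF assms(3) _ _ _ _ key] by blast
      then have "j \<in> R i \<or> j \<in> R i'" using * that(1) by (auto simp: R_def)
      then show ?thesis using iS by blast
    qed
    then have eq: "(\<Oplus>\<^bsub>F\<^esub>j\<in>?N. q i' j \<otimes>\<^bsub>F\<^esub> p j i) = (\<Oplus>\<^bsub>F\<^esub>j\<in>J. q i' j \<otimes>\<^bsub>F\<^esub> p j i)"
      using RJ pq[OF i] assms(2) by (intro add.finprod_mono_neutral_cong_left) auto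
    show ?thesis
    proof (cases "\<exists>t. t \<in> L i \<and> t + 2 * \<epsilon> \<in> L i'")
      case True
      then show ?thesis using entry[OF i] eq by auto
    next
      case False
      \<comment> \<open>Here no point allows the structure map to be evaluated. Still the entry is
        zero: the inequalities from a nonzero contribution would put
        \<open>u - 2 * \<epsilon>\<close> into \<open>L i\<close> and \<open>u\<close> into
        \<open>L i'\<close>. The case \<open>i = i'\<close> cannot occur, since bars of
        \<open>S\<close> are long.\<close>
      obtain u where u: "dshift (b i) (2 * \<epsilon>) \<le> DMinus u" "DPlus u \<le> d i'"
        using dinterval_ex[OF ov] by blast
      have zero: "q i' j \<otimes>\<^bsub>F\<^esub> p j i = \<zero>\<^bsub>F\<^esub>" if j: "j \<in> J" for j
      proof (rule ccontr)
        assume "q i' j \<otimes>\<^bsub>F\<^esub> p j i \<noteq> \<zero>\<^bsub>F\<^esub>"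
        then have le: "b' j \<le> dshift (b i) \<epsilon>" "d' j \<le> dshift (d i) \<epsilon>"
          "b i' \<le> dshift (b' j) \<epsilon>" "d i' \<le> dshift (d' j) \<epsilon>"
          using p(3)[OF i(1) j] q(3)[OF j i(2)] nz[OF i j] by auto
        have "b i' \<le> dshift (b i) (2 * \<epsilon>)" "d i' \<le> dshift (d i) (2 * \<epsilon>)"
          using order_trans[OF le(3) dshift_mono[OF le(1)]] order_trans[OF le(4) dshift_mono[OF le(2)]]
          by (simp_all add: dshift_dshift)
        then have "b i' \<le> DMinus u" "DPlus u \<le> dshift (d i) (2 * \<epsilon>)"
          using u by (auto intro: order_trans)
        moreover from this(2) have "DPlus (u - 2 * \<epsilon>) \<le> d i" by (cases "d i") auto
        moreover have "b i \<le> DMinus (u - 2 * \<epsilon>)" using u(1) by (simp add: dshift_le_iff)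
        ultimately have "u - 2 * \<epsilon> \<in> L i" "(u - 2 * \<epsilon>) + 2 * \<epsilon> \<in> L i'"
          using u(2) by (auto simp: L[OF i(1)] L[OF i(2)] mem_dinterval)
        with False show False by blast
      qed
      have "i \<noteq> i'"
      proof
        assume "i = i'"
        moreover obtain a where "{a..a + 2 * \<epsilon>} \<subseteq> dinterval (b i) (d i)"
          using contains_closed_iff[OF assms(3)] S(3)[OF iS(1)] by blast
        moreover have "a \<in> {a..a + 2 * \<epsilon>}" "a + 2 * \<epsilon> \<in> {a..a + 2 * \<epsilon>}" using assms(3) by auto
        ultimately show False using False unfolding L[OF i(1)] L[OF i(2)] by blast
      qed
      moreover have "(\<Oplus>\<^bsub>F\<^esub>j\<in>J. q i' j \<otimes>\<^bsub>F\<^esub> p j i) = \<zero>\<^bsub>F\<^esub>"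
        using zero by (intro add.finprod_one_eqI)
      ultimately show ?thesis using eq by simp
    qed
  qed
  moreover have "finite ?N" using RJ assms(2) finite_subset by blast
  ultimately show ?thesis
    using S(1,2) RJ p(1) q(1)
    by (intro card_le_if_unitriangular_product[of S ?N p q ?key]) blast+
qed

section \<open>From interleavings to matchings of indexed families\<close>

lemma interleaving_sym: "interleaving F \<epsilon> U V \<phi> \<psi> \<Longrightarrow> interleaving F \<epsilon> V U \<psi> \<phi>"
  by (simp add: interleaving_def)

text \<open>Decompositions come as indexed families, barcodes as multisets. This notion covers both:
  \<open>eps_matching\<close> is the case of the index sets \<open>bar_index B\<close> and
  \<open>bar_index B'\<close> with \<open>fst\<close> as the family.\<close>

definition family_matching ::
    "real \<Rightarrow> 'i set \<Rightarrow> ('i \<Rightarrow> real set) \<Rightarrow> 'j set \<Rightarrow> ('j \<Rightarrow> real set) \<Rightarrow> ('i \<times> 'j) set \<Rightarrow> bool" where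
  "family_matching \<epsilon> I L J L' M \<longleftrightarrow>
    M \<subseteq> I \<times> J \<and> single_valued M \<and> single_valued (M\<inverse>) \<and>
    (\<forall>i\<in>I. (\<exists>a. {a..a + 2 * \<epsilon>} \<subseteq> L i) \<longrightarrow> i \<in> Domain M) \<and>
    (\<forall>j\<in>J. (\<exists>a. {a..a + 2 * \<epsilon>} \<subseteq> L' j) \<longrightarrow> j \<in> Range M) \<and>
    (\<forall>(i, j)\<in>M. close_intervals \<epsilon> (L i) (L' j))"

lemma nonempty_interval_iff: "nonempty_interval L \<longleftrightarrow> (\<exists>b d. b < d \<and> L = dinterval b d)"
  unfolding nonempty_interval_def by (metis dinterval_nonempty_iff less_imp_le)

lemma nonempty_interval_endpoints:
  assumes "\<forall>i\<in>I. nonempty_interval (L i)"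
  shows "\<exists>b d. \<forall>i\<in>I. b i < d i \<and> L i = dinterval (b i) (d i)"
  using assms unfolding nonempty_interval_iff by metis

lemma matching_from_interleaving:
  assumes "field F" "finite I" "finite J" "\<epsilon> \<ge> 0"
    and L: "\<forall>i\<in>I. nonempty_interval (L i)" and L': "\<forall>j\<in>J. nonempty_interval (L' j)"
    and "interleaved F \<epsilon> (interval_sum F I L) (interval_sum F J L')"
  shows "\<exists>M. family_matching \<epsilon> I L J L' M"
proof -
  obtain b d where bd: "\<And>i. i \<in> I \<Longrightarrow> b i < d i" "\<And>i. i \<in> I \<Longrightarrow> L i = dinterval (b i) (d i)"
    using nonempty_interval_endpoints[OF L] by auto
  obtain b' d' where bd': "\<And>j. j \<in> J \<Longrightarrow> b' j < d' j" "\<And>j. j \<in> J \<Longrightarrow> L' j = dinterval (b' j) (d' j)"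
    using nonempty_interval_endpoints[OF L'] by auto
  obtain \<phi> \<psi> where inter: "interleaving F \<epsilon> (interval_sum F I L) (interval_sum F J L') \<phi> \<psi>"
    using assms(7) unfolding interleaved_def by blast
  \<comment> \<open>The relation is symmetric under exchange of the two families, so
    \<open>hall_condition\<close> supplies matchings inside it from either side.\<close>
  define E where "E = {(i, j). i \<in> I \<and> j \<in> J \<and> b' j \<le> dshift (b i) \<epsilon> \<and> d' j \<le> dshift (d i) \<epsilon> \<and>
    b i \<le> dshift (b' j) \<epsilon> \<and> d i \<le> dshift (d' j) \<epsilon>}"
  define S where "S = {i \<in> I. dshift (b i) (2 * \<epsilon>) < d i}"
  define T where "T = {j \<in> J. dshift (b' j) (2 * \<epsilon>) < d' j}"
  have "\<exists>f. inj_on f S \<and> (\<forall>i\<in>S. f i \<in> {j \<in> J. b' j \<le> dshift (b i) \<epsilon> \<and> d' j \<le> dshift (d i) \<epsilon> \<and>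
      b i \<le> dshift (b' j) \<epsilon> \<and> d i \<le> dshift (d' j) \<epsilon>})"
    using assms(2,3)
    by (intro hall_marriage hall_condition[OF assms(1,3,4) bd(2) bd'(2) inter])
      (auto simp: S_def intro: finite_subset)
  then obtain f where f: "inj_on f S" "\<And>i. i \<in> S \<Longrightarrow> (i, f i) \<in> E"
    by (auto simp: E_def S_def)
  have "\<exists>g. inj_on g T \<and> (\<forall>j\<in>T. g j \<in> {i \<in> I. b i \<le> dshift (b' j) \<epsilon> \<and> d i \<le> dshift (d' j) \<epsilon> \<and>
      b' j \<le> dshift (b i) \<epsilon> \<and> d' j \<le> dshift (d i) \<epsilon>})"
    using assms(2,3)
    by (intro hall_marriage hall_condition[OF assms(1,2,4) bd'(2) bd(2) interleaving_sym[OF inter]])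
      (auto simp: T_def intro: finite_subset)
  then obtain g where g: "inj_on g T" "\<And>j. j \<in> T \<Longrightarrow> (g j, j) \<in> E"
    by (auto simp: E_def T_def)
  obtain M where M: "M \<subseteq> E" "single_valued M" "single_valued (M\<inverse>)" "S \<subseteq> Domain M" "T \<subseteq> Range M"
    using combine_matchings[OF f g] by blast
  have close: "close_intervals \<epsilon> (L i) (L' j)" if "(i, j) \<in> M" for i j
  proof -
    have "(i, j) \<in> E" using that M(1) by blast
    then show ?thesis
      using close_intervals_iff[OF bd(1)[of i] bd'(1)[of j]] bd(2)[of i] bd'(2)[of j]
      by (simp add: E_def)
  qed
  have dom: "i \<in> Domain M" if "i \<in> I" "\<exists>a. {a..a + 2 * \<epsilon>} \<subseteq> L i" for i
  proof -
    have "i \<in> S"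
      using that contains_closed_iff[OF assms(4), of "b i" "d i"] bd(2)[of i] by (simp add: S_def)
    then show ?thesis using M(4) by blast
  qed
  have ran: "j \<in> Range M" if "j \<in> J" "\<exists>a. {a..a + 2 * \<epsilon>} \<subseteq> L' j" for j
  proof -
    have "j \<in> T"
      using that contains_closed_iff[OF assms(4), of "b' j" "d' j"] bd'(2)[of j]
      by (simp add: T_def)
    then show ?thesis using M(5) by blast
  qed
  have "M \<subseteq> I \<times> J" using M(1) by (auto simp: E_def)
  then have "family_matching \<epsilon> I L J L' M"
    using M(2,3) close dom ran by (simp add: family_matching_def split_beta)
  then show ?thesis by blast
qed

section \<open>From matchings to interleavings\<close>

lemma mem_dinterval_dshift:
  "t \<in> dinterval (dshift b (- \<epsilon>)) (dshift d \<epsilon>) \<longleftrightarrow> b \<le> DMinus (t + \<epsilon>) \<and> DPlus (t - \<epsilon>) \<le> d"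
proof -
  have "DPlus t \<le> dshift d \<epsilon> \<longleftrightarrow> DPlus (t - \<epsilon>) \<le> d" by (cases d) auto
  then show ?thesis by (simp add: mem_dinterval dshift_le_iff)
qed

lemma close_intervals_sym: "close_intervals \<epsilon> L L' \<Longrightarrow> close_intervals \<epsilon> L' L"
  unfolding close_intervals_def by blast

lemma close_intervalsD:
  assumes "close_intervals \<epsilon> L L'"
  shows close_intervals_mid: "t \<in> L \<Longrightarrow> t + 2 * \<epsilon> \<in> L \<Longrightarrow> t + \<epsilon> \<in> L'"
    and close_intervals_lower: "s \<in> L \<Longrightarrow> s \<le> t \<Longrightarrow> t + \<epsilon> \<in> L' \<Longrightarrow> s + \<epsilon> \<in> L'"
    and close_intervals_upper: "s \<in> L \<Longrightarrow> s \<le> t \<Longrightarrow> t + \<epsilon> \<in> L' \<Longrightarrow> t \<in> L"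
proof -
  obtain b d b' d' where L: "L = dinterval b d" and L': "L' = dinterval b' d'"
    and "L \<subseteq> dinterval (dshift b' (- \<epsilon>)) (dshift d' \<epsilon>)"
    and "L' \<subseteq> dinterval (dshift b (- \<epsilon>)) (dshift d \<epsilon>)"
    using assms unfolding close_intervals_def by blast
  then have 1: "b' \<le> DMinus (t + \<epsilon>) \<and> DPlus (t - \<epsilon>) \<le> d'" if "t \<in> L" for t
    using that mem_dinterval_dshift by blast
  have 2: "b \<le> DMinus (t + \<epsilon>) \<and> DPlus (t - \<epsilon>) \<le> d" if "t \<in> L'" for t
    using that \<open>L' \<subseteq> _\<close> mem_dinterval_dshift by blast
  show "t + \<epsilon> \<in> L'" if "t \<in> L" "t + 2 * \<epsilon> \<in> L"
    using 1[OF that(1)] 1[OF that(2)] by (simp add: L' mem_dinterval add.commute)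
  show "s + \<epsilon> \<in> L'" if "s \<in> L" "s \<le> t" "t + \<epsilon> \<in> L'"
    using 1[OF that(1)] that(2,3) order_trans[of "DPlus (s + \<epsilon>)" "DPlus (t + \<epsilon>)" d']
    by (simp add: L' mem_dinterval)
  show "t \<in> L" if "s \<in> L" "s \<le> t" "t + \<epsilon> \<in> L'"
    using 2[OF that(3)] that(1,2) order_trans[of b "DMinus s" "DMinus t"]
    by (simp add: L mem_dinterval)
qed

text \<open>The sum of the canonical maps between matched bars. The description by
  \<open>THE\<close> reads off the partner of \<open>j\<close>, which is unique when
  \<open>M\<inverse>\<close> is single valued.\<close>

definition matching_map ::
    "('a, 'm) ring_scheme \<Rightarrow> real \<Rightarrow> ('i \<times> 'j) set \<Rightarrow> ('i \<Rightarrow> real set) \<Rightarrow> 'j set \<Rightarrow> ('j \<Rightarrow> real set)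
      \<Rightarrow> real \<Rightarrow> ('i \<Rightarrow> 'a) \<Rightarrow> 'j \<Rightarrow> 'a" where
  "matching_map F \<epsilon> M L J L' t x = (\<lambda>j\<in>J.
    if \<exists>i. (i, j) \<in> M \<and> t \<in> L i \<and> t + \<epsilon> \<in> L' j then x (THE i. (i, j) \<in> M) else \<zero>\<^bsub>F\<^esub>)"

lemma matching_map_matched:
  assumes "single_valued (M\<inverse>)" "(i, j) \<in> M" "j \<in> J"
  shows "matching_map F \<epsilon> M L J L' t x j = (if t \<in> L i \<and> t + \<epsilon> \<in> L' j then x i else \<zero>\<^bsub>F\<^esub>)"
proof -
  have uniq: "k = i" if "(k, j) \<in> M" for k
    using assms(1,2) that by (auto simp: single_valued_def)
  have "(THE i. (i, j) \<in> M) = i" using assms(2) uniq by (rule the_equality)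
  moreover have "(\<exists>k. (k, j) \<in> M \<and> t \<in> L k \<and> t + \<epsilon> \<in> L' j) \<longleftrightarrow> t \<in> L i \<and> t + \<epsilon> \<in> L' j"
    using assms(2) uniq by blast
  ultimately show ?thesis using assms(3) by (simp add: matching_map_def)
qed

lemma matching_map_unmatched:
  assumes "j \<notin> Range M" "j \<in> J"
  shows "matching_map F \<epsilon> M L J L' t x j = \<zero>\<^bsub>F\<^esub>"
  using assms by (auto simp: matching_map_def)

text \<open>Reduces linearity, naturality and the composition law to a check at one matched pair,
  where the canonical map is explicit, or at an unmatched index, where everything is zero.\<close>

lemma matching_map_ext:
  assumes "single_valued (M\<inverse>)" "y \<in> extensional J"
    and "\<And>i j. (i, j) \<in> M \<Longrightarrow> j \<in> J \<Longrightarrow> y j = (if t \<in> L i \<and> t + \<epsilon> \<in> L' j then x i else \<zero>\<^bsub>F\<^esub>)"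
    and "\<And>j. j \<in> J \<Longrightarrow> j \<notin> Range M \<Longrightarrow> y j = \<zero>\<^bsub>F\<^esub>"
  shows "matching_map F \<epsilon> M L J L' t x = y"
proof (rule extensionalityI)
  show "matching_map F \<epsilon> M L J L' t x \<in> extensional J" by (simp add: matching_map_def)
  show "matching_map F \<epsilon> M L J L' t x j = y j" if "j \<in> J" for j
  proof (cases "j \<in> Range M")
    case True
    then obtain i where i: "(i, j) \<in> M" by blast
    show ?thesis using assms(3)[OF i that] by (simp add: matching_map_matched[OF assms(1) i that])
  next
    case False
    then show ?thesis using assms(4)[OF that False] by (simp add: matching_map_unmatched[OF False that])
  qed
qed (rule assms(2))

lemma matching_map_morphism:
  assumes "field F" "M \<subseteq> I \<times> J" "single_valued (M\<inverse>)"
    and close: "\<And>i j. (i, j) \<in> M \<Longrightarrow> close_intervals \<epsilon> (L i) (L' j)"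
  shows "pmorphism F (interval_sum F I L) (pshift \<epsilon> (interval_sum F J L'))
    (matching_map F \<epsilon> M L J L')"
proof -
  interpret field F by fact
  let ?f = "matching_map F \<epsilon> M L J L'" and ?U = "interval_sum F I L" and ?V = "interval_sum F J L'"
  note matched = matching_map_matched[OF assms(3)]
  have I: "i \<in> I" if "(i, j) \<in> M" for i j using assms(2) that by auto
  have coord: "x i \<in> carrier F" if "x \<in> carrier (vspace ?U t)" "i \<in> I" for x t i
    using that by (auto simp: interval_sum_carrier PiE_iff split: if_splits)
  have outside: "x i = \<zero>\<^bsub>F\<^esub>" if "x \<in> carrier (vspace ?U t)" "i \<in> I" "t \<notin> L i" for x t i
    using that by (auto simp: interval_sum_carrier PiE_iff)
  have closed: "?f t x \<in> carrier (vspace ?V (t + \<epsilon>))" if x: "x \<in> carrier (vspace ?U t)" for t x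
    unfolding interval_sum_carrier
  proof (rule PiE_I)
    fix j assume j: "j \<in> J"
    show "?f t x j \<in> (if t + \<epsilon> \<in> L' j then carrier F else {\<zero>\<^bsub>F\<^esub>})"
    proof (cases "j \<in> Range M")
      case True
      then obtain i where i: "(i, j) \<in> M" by blast
      show ?thesis using coord[OF x I[OF i]] by (simp add: matched[OF i j])
    next
      case False
      then show ?thesis by (simp add: matching_map_unmatched[OF False j])
    qed
  qed (simp add: matching_map_def)
  have "?f t \<in> linear_maps F (vspace ?U t) (vspace ?V (t + \<epsilon>))" for t
  proof (rule linear_mapsI)
    fix x y assume xy: "x \<in> carrier (vspace ?U t)" "y \<in> carrier (vspace ?U t)"
    show "?f t (x \<oplus>\<^bsub>vspace ?U t\<^esub> y) = ?f t x \<oplus>\<^bsub>vspace ?V (t + \<epsilon>)\<^esub> ?f t y"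
      by (rule matching_map_ext[OF assms(3)])
        (use coord[OF xy(1)] coord[OF xy(2)] I in
          \<open>auto simp: interval_sum_add matched matching_map_unmatched\<close>)
  next
    fix a x assume a: "a \<in> carrier F" and x: "x \<in> carrier (vspace ?U t)"
    show "?f t (a \<odot>\<^bsub>vspace ?U t\<^esub> x) = a \<odot>\<^bsub>vspace ?V (t + \<epsilon>)\<^esub> ?f t x"
      by (rule matching_map_ext[OF assms(3)])
        (use a coord[OF x] I in
          \<open>auto simp: interval_sum_smult matched matching_map_unmatched\<close>)
  qed (rule closed)
  moreover have "?f t (smap ?U s t x) = smap ?V (s + \<epsilon>) (t + \<epsilon>) (?f s x)"
    if "s \<le> t" and x: "x \<in> carrier (vspace ?U s)" for s t x
  proof (rule matching_map_ext[OF assms(3)])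
    fix i j assume ij: "(i, j) \<in> M" "j \<in> J"
    show "smap ?V (s + \<epsilon>) (t + \<epsilon>) (?f s x) j =
        (if t \<in> L i \<and> t + \<epsilon> \<in> L' j then smap ?U s t x i else \<zero>\<^bsub>F\<^esub>)"
      using ij I[OF ij(1)] close_intervals_lower[OF close[OF ij(1)], of s t]
        close_intervals_upper[OF close[OF ij(1)], of s t] \<open>s \<le> t\<close>
      by (auto simp: interval_sum_smap matched[OF ij])
  next
    fix j assume "j \<in> J" "j \<notin> Range M"
    then show "smap ?V (s + \<epsilon>) (t + \<epsilon>) (?f s x) j = \<zero>\<^bsub>F\<^esub>"
      by (simp add: interval_sum_smap matching_map_unmatched)
  qed (simp add: interval_sum_smap)
  ultimately show ?thesis by (simp add: pmorphism_def)
qed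

lemma nonempty_interval_convex:
  assumes "nonempty_interval L" "s \<in> L" "u \<in> L" "s \<le> t" "t \<le> u"
  shows "t \<in> L"
proof -
  obtain b d where L: "L = dinterval b d" using assms(1) by (auto simp: nonempty_interval_iff)
  show ?thesis
    using assms(2-) order_trans[of b "DMinus s" "DMinus t"] order_trans[of "DPlus t" "DPlus u" d]
    by (simp add: L mem_dinterval)
qed

lemma matching_map_comp:
  assumes "field F" "M \<subseteq> I \<times> J" "single_valued M" "single_valued (M\<inverse>)"
    and L: "\<forall>i\<in>I. nonempty_interval (L i)"
    and long: "\<And>i. i \<in> I \<Longrightarrow> (\<exists>a. {a..a + 2 * \<epsilon>} \<subseteq> L i) \<Longrightarrow> i \<in> Domain M"
    and close: "\<And>i j. (i, j) \<in> M \<Longrightarrow> close_intervals \<epsilon> (L i) (L' j)"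
  shows "matching_map F \<epsilon> (M\<inverse>) L' I L (t + \<epsilon>) (matching_map F \<epsilon> M L J L' t x) =
    smap (interval_sum F I L) t (t + 2 * \<epsilon>) x"
proof (rule matching_map_ext)
  show "single_valued ((M\<inverse>)\<inverse>)" using assms(3) by simp
  show "smap (interval_sum F I L) t (t + 2 * \<epsilon>) x \<in> extensional I" by (simp add: interval_sum_smap)
next
  fix j i assume "(j, i) \<in> M\<inverse>" "i \<in> I"
  then have ij: "(i, j) \<in> M" "j \<in> J" using assms(2) by auto
  show "smap (interval_sum F I L) t (t + 2 * \<epsilon>) x i =
      (if t + \<epsilon> \<in> L' j \<and> t + \<epsilon> + \<epsilon> \<in> L i then matching_map F \<epsilon> M L J L' t x j else \<zero>\<^bsub>F\<^esub>)"
    using \<open>i \<in> I\<close> close_intervals_mid[OF close[OF ij(1)], of t]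
    by (auto simp: matching_map_matched[OF assms(4) ij] interval_sum_smap add.assoc)
next
  fix i assume i: "i \<in> I" "i \<notin> Range (M\<inverse>)"
  have "t \<notin> L i \<or> t + 2 * \<epsilon> \<notin> L i"
  proof (rule ccontr)
    assume "\<not> ?thesis"
    then have "{t..t + 2 * \<epsilon>} \<subseteq> L i"
      using nonempty_interval_convex[of "L i" t "t + 2 * \<epsilon>"] L i(1) by auto
    with long i show False by auto
  qed
  then show "smap (interval_sum F I L) t (t + 2 * \<epsilon>) x i = \<zero>\<^bsub>F\<^esub>"
    using i by (auto simp: interval_sum_smap)
qed

lemma interleaving_from_matching:
  assumes "field F" "\<forall>i\<in>I. nonempty_interval (L i)" "\<forall>j\<in>J. nonempty_interval (L' j)"
    and M: "family_matching \<epsilon> I L J L' M"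
  shows "interleaved F \<epsilon> (interval_sum F I L) (interval_sum F J L')"
proof -
  have M': "M \<subseteq> I \<times> J" "single_valued M" "single_valued (M\<inverse>)"
    and close: "\<And>i j. (i, j) \<in> M \<Longrightarrow> close_intervals \<epsilon> (L i) (L' j)"
    and long: "\<And>i. i \<in> I \<Longrightarrow> (\<exists>a. {a..a + 2 * \<epsilon>} \<subseteq> L i) \<Longrightarrow> i \<in> Domain M"
      "\<And>j. j \<in> J \<Longrightarrow> (\<exists>a. {a..a + 2 * \<epsilon>} \<subseteq> L' j) \<Longrightarrow> j \<in> Domain (M\<inverse>)"
    using M unfolding family_matching_def by auto
  have conv: "M\<inverse> \<subseteq> J \<times> I" "single_valued ((M\<inverse>)\<inverse>)"
    and close': "\<And>j i. (j, i) \<in> M\<inverse> \<Longrightarrow> close_intervals \<epsilon> (L' j) (L i)"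
    using M' close close_intervals_sym by auto
  have "interleaving F \<epsilon> (interval_sum F I L) (interval_sum F J L')
      (matching_map F \<epsilon> M L J L') (matching_map F \<epsilon> (M\<inverse>) L' I L)"
    unfolding interleaving_def
    using matching_map_morphism[OF assms(1) M'(1,3) close]
      matching_map_morphism[OF assms(1) conv close']
      matching_map_comp[OF assms(1) M' assms(2) long(1) close]
      matching_map_comp[OF assms(1) conv(1) M'(3) conv(2) assms(3) long(2) close']
    by simp
  then show ?thesis unfolding interleaved_def by blast
qed

section \<open>Transport along isomorphisms\<close>

lemma pmorphism_linear: "pmorphism F U V f \<Longrightarrow> f t \<in> linear_maps F (vspace U t) (vspace V t)"
  by (simp add: pmorphism_def)

lemma pmorphism_closed:
  "pmorphism F U V f \<Longrightarrow> x \<in> carrier (vspace U t) \<Longrightarrow> f t x \<in> carrier (vspace V t)"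
  by (rule linear_mapsD(1)[OF pmorphism_linear])

lemma pmorphism_natural:
  "pmorphism F U V f \<Longrightarrow> s \<le> t \<Longrightarrow> x \<in> carrier (vspace U s) \<Longrightarrow>
    f t (smap U s t x) = smap V s t (f s x)"
  by (simp add: pmorphism_def)

lemma pmorphism_comp:
  assumes f: "pmorphism F U V f" and g: "pmorphism F V W g"
  shows "pmorphism F U W (\<lambda>t x. g t (f t x))"
  unfolding pmorphism_def
proof (intro conjI allI impI ballI)
  show "(\<lambda>x. g t (f t x)) \<in> linear_maps F (vspace U t) (vspace W t)" for t
    by (rule linear_maps_comp[of "f t" F "vspace U t" "vspace V t" "g t"])
      (rule pmorphism_linear[OF f], rule pmorphism_linear[OF g])
  show "g t (f t (smap U s t x)) = smap W s t (g s (f s x))"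
    if "s \<le> t" "x \<in> carrier (vspace U s)" for s t x
    by (simp only: pmorphism_natural[OF f that] pmorphism_natural[OF g that(1) pmorphism_closed[OF f that(2)]])
qed

lemma pmorphism_pshift:
  "pmorphism F U V f \<Longrightarrow> pmorphism F (pshift \<epsilon> U) (pshift \<epsilon> V) (\<lambda>t. f (t + \<epsilon>))"
  by (simp add: pmorphism_def)

definition inverse_morphisms ::
    "('a, 'm) ring_scheme \<Rightarrow> ('a, 'v) pmod \<Rightarrow> ('a, 'w) pmod
      \<Rightarrow> (real \<Rightarrow> 'v \<Rightarrow> 'w) \<Rightarrow> (real \<Rightarrow> 'w \<Rightarrow> 'v) \<Rightarrow> bool" where
  "inverse_morphisms F U V f g \<longleftrightarrow> pmorphism F U V f \<and> pmorphism F V U g \<and>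
    (\<forall>t. \<forall>x\<in>carrier (vspace U t). g t (f t x) = x) \<and>
    (\<forall>t. \<forall>y\<in>carrier (vspace V t). f t (g t y) = y)"

lemma pisomorphic_iff: "pisomorphic F U V \<longleftrightarrow> (\<exists>f g. inverse_morphisms F U V f g)"
  by (simp add: pisomorphic_def inverse_morphisms_def)

lemma inverse_morphisms_sym: "inverse_morphisms F U V f g \<Longrightarrow> inverse_morphisms F V U g f"
  by (simp add: inverse_morphisms_def)

lemma pisomorphic_sym: "pisomorphic F U V \<Longrightarrow> pisomorphic F V U"
  using inverse_morphisms_sym unfolding pisomorphic_iff by blast

text \<open>In the middle \<open>g'\<close> cancels \<open>g\<close>, and naturality of
  \<open>f\<close> moves the structure map from \<open>U\<close> to \<open>U'\<close>. Stated for
  one composite, it yields the other by exchanging the roles of the modules.\<close>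

lemma conjugate_interleaving_comp:
  assumes "\<epsilon> \<ge> 0"
    and phi: "pmorphism F U (pshift \<epsilon> V) \<phi>"
    and comp: "\<And>t x. x \<in> carrier (vspace U t) \<Longrightarrow> \<psi> (t + \<epsilon>) (\<phi> t x) = smap U t (t + 2 * \<epsilon>) x"
    and f: "pmorphism F U U' f" and f': "pmorphism F U' U f'"
    and ff': "\<And>t x. x \<in> carrier (vspace U' t) \<Longrightarrow> f t (f' t x) = x"
    and g'g: "\<And>t y. y \<in> carrier (vspace V t) \<Longrightarrow> g' t (g t y) = y"
    and x: "x \<in> carrier (vspace U' t)"
  shows "f (t + \<epsilon> + \<epsilon>) (\<psi> (t + \<epsilon>) (g' (t + \<epsilon>) (g (t + \<epsilon>) (\<phi> t (f' t x))))) =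
    smap U' t (t + 2 * \<epsilon>) x"
proof -
  have x': "f' t x \<in> carrier (vspace U t)" by (rule pmorphism_closed[OF f' x])
  then have "\<phi> t (f' t x) \<in> carrier (vspace V (t + \<epsilon>))"
    using pmorphism_closed[OF phi] by simp
  then have "f (t + \<epsilon> + \<epsilon>) (\<psi> (t + \<epsilon>) (g' (t + \<epsilon>) (g (t + \<epsilon>) (\<phi> t (f' t x))))) =
      f (t + 2 * \<epsilon>) (smap U t (t + 2 * \<epsilon>) (f' t x))"
    using g'g comp[OF x'] by (simp add: add.assoc)
  also have "\<dots> = smap U' t (t + 2 * \<epsilon>) x"
    using pmorphism_natural[OF f _ x', of "t + 2 * \<epsilon>"] assms(1) ff'[OF x] by simp
  finally show ?thesis .
qed

lemma interleaved_isomorphic: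
  assumes "\<epsilon> \<ge> 0" "pisomorphic F U U'" "pisomorphic F V V'" "interleaved F \<epsilon> U V"
  shows "interleaved F \<epsilon> U' V'"
proof -
  obtain f f' where "inverse_morphisms F U U' f f'"
    using assms(2) unfolding pisomorphic_iff by blast
  then have f: "pmorphism F U U' f" "pmorphism F U' U f'"
    "\<And>t x. x \<in> carrier (vspace U t) \<Longrightarrow> f' t (f t x) = x"
    "\<And>t x. x \<in> carrier (vspace U' t) \<Longrightarrow> f t (f' t x) = x"
    by (auto simp: inverse_morphisms_def)
  obtain g g' where "inverse_morphisms F V V' g g'"
    using assms(3) unfolding pisomorphic_iff by blast
  then have g: "pmorphism F V V' g" "pmorphism F V' V g'"
    "\<And>t y. y \<in> carrier (vspace V t) \<Longrightarrow> g' t (g t y) = y"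
    "\<And>t y. y \<in> carrier (vspace V' t) \<Longrightarrow> g t (g' t y) = y"
    by (auto simp: inverse_morphisms_def)
  obtain \<phi> \<psi> where "interleaving F \<epsilon> U V \<phi> \<psi>"
    using assms(4) unfolding interleaved_def by blast
  then have inter: "pmorphism F U (pshift \<epsilon> V) \<phi>" "pmorphism F V (pshift \<epsilon> U) \<psi>"
    "\<And>t x. x \<in> carrier (vspace U t) \<Longrightarrow> \<psi> (t + \<epsilon>) (\<phi> t x) = smap U t (t + 2 * \<epsilon>) x"
    "\<And>t y. y \<in> carrier (vspace V t) \<Longrightarrow> \<phi> (t + \<epsilon>) (\<psi> t y) = smap V t (t + 2 * \<epsilon>) y"
    unfolding interleaving_def by auto
  have "interleaving F \<epsilon> U' V' (\<lambda>t x. g (t + \<epsilon>) (\<phi> t (f' t x))) (\<lambda>t y. f (t + \<epsilon>) (\<psi> t (g' t y)))"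
    unfolding interleaving_def
  proof (intro conjI allI ballI)
    show "pmorphism F U' (pshift \<epsilon> V') (\<lambda>t x. g (t + \<epsilon>) (\<phi> t (f' t x)))"
      by (rule pmorphism_comp[OF pmorphism_comp[OF f(2) inter(1)] pmorphism_pshift[OF g(1)]])
    show "pmorphism F V' (pshift \<epsilon> U') (\<lambda>t y. f (t + \<epsilon>) (\<psi> t (g' t y)))"
      by (rule pmorphism_comp[OF pmorphism_comp[OF g(2) inter(2)] pmorphism_pshift[OF f(1)]])
  next
    fix t x assume x: "x \<in> carrier (vspace U' t)"
    show "f (t + \<epsilon> + \<epsilon>) (\<psi> (t + \<epsilon>) (g' (t + \<epsilon>) (g (t + \<epsilon>) (\<phi> t (f' t x))))) =
        smap U' t (t + 2 * \<epsilon>) x"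
      by (rule conjugate_interleaving_comp[where V = V and \<psi> = \<psi> and g = g and g' = g',
            OF assms(1) inter(1) _ f(1,2) _ _ x]) (fact inter(3) f(4) g(3))+
  next
    fix t y assume y: "y \<in> carrier (vspace V' t)"
    show "g (t + \<epsilon> + \<epsilon>) (\<phi> (t + \<epsilon>) (f' (t + \<epsilon>) (f (t + \<epsilon>) (\<psi> t (g' t y))))) =
        smap V' t (t + 2 * \<epsilon>) y"
      by (rule conjugate_interleaving_comp[where V = U and \<psi> = \<phi> and g = f and g' = f',
            OF assms(1) inter(2) _ g(1,2) _ _ y]) (fact inter(4) g(4) f(3))+
  qed
  then show ?thesis unfolding interleaved_def by blast
qed

text \<open>Starting point for the uniqueness of barcodes: two decompositions of one module become
  $0$-interleaved sums.\<close>

lemma interleaved_refl: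
  assumes "persistence_module F V"
  shows "interleaved F 0 V V"
proof -
  interpret persistence_module F V by fact
  have "interleaving F 0 V V (\<lambda>_ x. x) (\<lambda>_ x. x)"
    by (auto simp: interleaving_def pmorphism_def smap_id intro: linear_mapsI)
  then show ?thesis unfolding interleaved_def by blast
qed

section \<open>Barcodes\<close>

lemma interleaved_iff_family_matching:
  assumes "field F" "\<epsilon> \<ge> 0"
    and U: "interval_decomposition F U I L" and V: "interval_decomposition F V J L'"
  shows "interleaved F \<epsilon> U V \<longleftrightarrow> (\<exists>M. family_matching \<epsilon> I L J L' M)"
proof -
  have I: "finite I" "\<forall>i\<in>I. nonempty_interval (L i)" "pisomorphic F U (interval_sum F I L)"
    and J: "finite J" "\<forall>j\<in>J. nonempty_interval (L' j)" "pisomorphic F V (interval_sum F J L')"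
    using U V unfolding interval_decomposition_def by auto
  show ?thesis
  proof
    assume "interleaved F \<epsilon> U V"
    then have "interleaved F \<epsilon> (interval_sum F I L) (interval_sum F J L')"
      by (rule interleaved_isomorphic[OF assms(2) I(3) J(3)])
    then show "\<exists>M. family_matching \<epsilon> I L J L' M"
      by (rule matching_from_interleaving[OF assms(1) I(1) J(1) assms(2) I(2) J(2)])
  next
    assume "\<exists>M. family_matching \<epsilon> I L J L' M"
    then have "interleaved F \<epsilon> (interval_sum F I L) (interval_sum F J L')"
      using interleaving_from_matching[OF assms(1) I(2) J(2)] by blast
    then show "interleaved F \<epsilon> U V"
      by (rule interleaved_isomorphic[OF assms(2) pisomorphic_sym[OF I(3)] pisomorphic_sym[OF J(3)]])
  qed
qed

text \<open>Every nonempty bar contains a closed interval of length zero and is therefore matched,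
  and closeness at zero is equality. So \<open>M\<close> is the graph of a bijection that preserves
  bars.\<close>

lemma family_matching_0_imp_barcode_eq:
  assumes "family_matching 0 I L J L' M"
    and "\<forall>i\<in>I. nonempty_interval (L i)" "\<forall>j\<in>J. nonempty_interval (L' j)"
  shows "image_mset L (mset_set I) = image_mset L' (mset_set J)"
proof -
  have point: "\<exists>a. {a..a + 2 * 0} \<subseteq> K" if "nonempty_interval K" for K :: "real set"
    using that by (auto simp: nonempty_interval_def)
  have M: "M \<subseteq> I \<times> J" "single_valued M" "single_valued (M\<inverse>)" "I \<subseteq> Domain M" "J \<subseteq> Range M"
    and close: "\<forall>(i, j)\<in>M. close_intervals 0 (L i) (L' j)"
    using assms point unfolding family_matching_def by blast+
  have eq: "L (fst m) = L' (snd m)" if "m \<in> M" for m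
  proof -
    have "close_intervals 0 (L (fst m)) (L' (snd m))" using close that by auto
    then show ?thesis by (auto simp: close_intervals_def)
  qed
  have "inj_on fst M" "inj_on snd M"
    using M(2,3) by (auto simp: inj_on_def single_valued_def)
  moreover have "I = fst ` M" "J = snd ` M" using M(1,4,5) by force+
  ultimately have "mset_set I = image_mset fst (mset_set M)" "mset_set J = image_mset snd (mset_set M)"
    by (simp_all add: image_mset_mset_set)
  moreover have "image_mset (L \<circ> fst) (mset_set M) = image_mset (L' \<circ> snd) (mset_set M)"
  \<comment> \<open>For infinite \<open>M\<close> both multisets are empty by the convention of
    \<open>mset_set\<close>.\<close>
  proof (cases "finite M")
    case True
    then show ?thesis using eq by (intro image_mset_cong) simp
  qed simp
  ultimately show ?thesis by (simp add: multiset.map_comp)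
qed

text \<open>Resolves the definite description in \<open>bar\<close>: uniqueness comes from the
  identity, a $0$-interleaving between any two decompositions of \<open>V\<close>.\<close>

lemma bar_eq:
  assumes "persistence_module F V" "interval_decomposition F V I L"
  shows "bar F V = image_mset L (mset_set I)"
proof -
  have "field F" using assms(1) by (rule persistence_module.field)
  have uniq: "image_mset L' (mset_set J) = image_mset L (mset_set I)"
    if J: "interval_decomposition F V J L'" for J L'
  proof -
    obtain M where "family_matching 0 J L' I L M"
      using interleaved_iff_family_matching[OF \<open>field F\<close> order_refl J assms(2)]
        interleaved_refl[OF assms(1)] by blast
    then show ?thesis
      using J assms(2) unfolding interval_decomposition_def
      by (intro family_matching_0_imp_barcode_eq) auto
  qed
  show ?thesis
    unfolding bar_def
  proof (rule the_equality)
    show "\<exists>J L'. interval_decomposition F V J L' \<and>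
        image_mset L (mset_set I) = image_mset L' (mset_set J)"
      by (intro exI[of _ I] exI[of _ L]) (simp add: assms(2))
  next
    fix B assume "\<exists>J L'. interval_decomposition F V J L' \<and> B = image_mset L' (mset_set J)"
    then show "B = image_mset L (mset_set I)" using uniq by (elim exE conjE) (simp only:)
  qed
qed

section \<open>Passage between indexed families and multisets of bars\<close>

lemma bar_index_bij:
  assumes "finite I"
  obtains \<sigma> where "bij_betw \<sigma> I (bar_index (image_mset L (mset_set I)))" "\<And>i. i \<in> I \<Longrightarrow> fst (\<sigma> i) = L i"
proof -
  let ?B = "image_mset L (mset_set I)"
  have count: "count ?B K = card {i \<in> I. L i = K}" for K
  proof -
    have "{i. i \<in># mset_set I \<and> K = L i} = {i \<in> I. L i = K}" using assms by auto
    then show ?thesis using assms by (simp add: count_image_mset')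
  qed
  \<comment> \<open>For each bar \<open>K\<close>, \<open>h K\<close> numbers the indices that carry
    it; these numbers are the copy numbers in \<open>bar_index\<close>.\<close>
  have "\<forall>K. \<exists>h. bij_betw h {i \<in> I. L i = K} {..<count ?B K}"
    using assms by (intro allI finite_same_card_bij) (auto simp: count)
  then obtain h where h: "\<And>K. bij_betw (h K) {i \<in> I. L i = K} {..<count ?B K}" by metis
  have "bij_betw (\<lambda>i. (L i, h (L i) i)) I (bar_index ?B)"
    unfolding bij_betw_def
  proof
    show "inj_on (\<lambda>i. (L i, h (L i) i)) I"
    proof (rule inj_onI)
      fix i k assume ik: "i \<in> I" "k \<in> I" "(L i, h (L i) i) = (L k, h (L k) k)"
      then show "i = k" using bij_betw_imp_inj_on[OF h[of "L k"]] by (auto dest: inj_onD)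
    qed
    show "(\<lambda>i. (L i, h (L i) i)) ` I = bar_index ?B"
    proof (intro equalityI subsetI)
      fix z assume "z \<in> (\<lambda>i. (L i, h (L i) i)) ` I"
      then obtain i where i: "i \<in> I" "z = (L i, h (L i) i)" by blast
      then show "z \<in> bar_index ?B"
        using bij_betwE[OF h[of "L i"]] by (auto simp: bar_index_def)
    next
      fix z assume "z \<in> bar_index ?B"
      then obtain K k where z: "z = (K, k)" "k \<in> {..<count ?B K}" by (auto simp: bar_index_def)
      then have "k \<in> h K ` {i \<in> I. L i = K}"
        by (simp only: bij_betw_imp_surj_on[OF h])
      then obtain i where "i \<in> I" "L i = K" "k = h K i" by blast
      then show "z \<in> (\<lambda>i. (L i, h (L i) i)) ` I" using z by auto
    qed
  qed
  then show thesis by (rule that) simp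
qed

lemma family_matching_reindex:
  assumes M: "family_matching \<epsilon> I L J L' M"
    and s: "bij_betw \<sigma> I I2" "\<And>i. i \<in> I \<Longrightarrow> K (\<sigma> i) = L i"
    and t: "bij_betw \<tau> J J2" "\<And>j. j \<in> J \<Longrightarrow> K' (\<tau> j) = L' j"
  shows "family_matching \<epsilon> I2 K J2 K' (map_prod \<sigma> \<tau> ` M)"
proof -
  have I2: "I2 = \<sigma> ` I" "inj_on \<sigma> I" and J2: "J2 = \<tau> ` J" "inj_on \<tau> J"
    using s(1) t(1) by (auto simp: bij_betw_def)
  have M': "M \<subseteq> I \<times> J" "single_valued M" "single_valued (M\<inverse>)"
    and long: "\<forall>i\<in>I. (\<exists>a. {a..a + 2 * \<epsilon>} \<subseteq> L i) \<longrightarrow> i \<in> Domain M"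
      "\<forall>j\<in>J. (\<exists>a. {a..a + 2 * \<epsilon>} \<subseteq> L' j) \<longrightarrow> j \<in> Range M"
    and close: "\<And>i j. (i, j) \<in> M \<Longrightarrow> close_intervals \<epsilon> (L i) (L' j)"
    using M unfolding family_matching_def by auto
  have sub: "i \<in> I \<and> j \<in> J" if "(i, j) \<in> M" for i j using M'(1) that by blast
  show ?thesis
    unfolding family_matching_def
  proof (intro conjI)
    show "map_prod \<sigma> \<tau> ` M \<subseteq> I2 \<times> J2" using sub by (auto simp: I2 J2)
    show "single_valued (map_prod \<sigma> \<tau> ` M)"
    proof (rule single_valuedI, clarsimp)
      fix i j i' j' assume ij: "(i, j) \<in> M" "(i', j') \<in> M" "\<sigma> i = \<sigma> i'"
      then have "i = i'" using sub inj_onD[OF I2(2)] by blast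
      then show "\<tau> j = \<tau> j'" using ij M'(2) by (auto simp: single_valued_def)
    qed
    show "single_valued ((map_prod \<sigma> \<tau> ` M)\<inverse>)"
    proof (rule single_valuedI, clarsimp)
      fix i j i' j' assume ij: "(i, j) \<in> M" "(i', j') \<in> M" "\<tau> j = \<tau> j'"
      then have "j = j'" using sub inj_onD[OF J2(2)] by blast
      then show "\<sigma> i = \<sigma> i'" using ij M'(3) by (auto simp: single_valued_def)
    qed
    show "\<forall>i\<in>I2. (\<exists>a. {a..a + 2 * \<epsilon>} \<subseteq> K i) \<longrightarrow> i \<in> Domain (map_prod \<sigma> \<tau> ` M)"
      using long(1) s(2) by (force simp: I2)
    show "\<forall>j\<in>J2. (\<exists>a. {a..a + 2 * \<epsilon>} \<subseteq> K' j) \<longrightarrow> j \<in> Range (map_prod \<sigma> \<tau> ` M)"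
      using long(2) t(2) by (force simp: J2)
    show "\<forall>(i, j)\<in>map_prod \<sigma> \<tau> ` M. close_intervals \<epsilon> (K i) (K' j)"
      using close sub s(2) t(2) by auto
  qed
qed

lemma eps_matching_iff_family_matching:
  "eps_matching \<epsilon> B B' M \<longleftrightarrow> family_matching \<epsilon> (bar_index B) fst (bar_index B') fst M"
  by (auto simp: eps_matching_def barcode_matching_def family_matching_def)

lemma eps_matched_iff_family_matching:
  assumes "finite I" "finite J"
  shows "eps_matched \<epsilon> (image_mset L (mset_set I)) (image_mset L' (mset_set J)) \<longleftrightarrow>
    (\<exists>M. family_matching \<epsilon> I L J L' M)"
proof -
  let ?B = "image_mset L (mset_set I)" and ?B' = "image_mset L' (mset_set J)"
  obtain \<sigma> where s: "bij_betw \<sigma> I (bar_index ?B)" "\<And>i. i \<in> I \<Longrightarrow> fst (\<sigma> i) = L i"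
    using bar_index_bij[OF assms(1)] by blast
  obtain \<tau> where t: "bij_betw \<tau> J (bar_index ?B')" "\<And>j. j \<in> J \<Longrightarrow> fst (\<tau> j) = L' j"
    using bar_index_bij[OF assms(2)] by blast
  have s': "L (inv_into I \<sigma> z) = fst z" if "z \<in> bar_index ?B" for z
    using s(2)[of "inv_into I \<sigma> z"] bij_betw_inv_into_right[OF s(1) that]
      bij_betwE[OF bij_betw_inv_into[OF s(1)]] that by simp
  have t': "L' (inv_into J \<tau> z) = fst z" if "z \<in> bar_index ?B'" for z
    using t(2)[of "inv_into J \<tau> z"] bij_betw_inv_into_right[OF t(1) that]
      bij_betwE[OF bij_betw_inv_into[OF t(1)]] that by simp
  show ?thesis
    unfolding eps_matched_def eps_matching_iff_family_matching
  proof
    assume "\<exists>M. family_matching \<epsilon> (bar_index ?B) fst (bar_index ?B') fst M"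
    then obtain M where "family_matching \<epsilon> (bar_index ?B) fst (bar_index ?B') fst M" ..
    then show "\<exists>M. family_matching \<epsilon> I L J L' M"
      by (intro exI) (rule family_matching_reindex[where K = L and K' = L' and L = fst and L' = fst,
            OF _ bij_betw_inv_into[OF s(1)] s'
            bij_betw_inv_into[OF t(1)] t'])
  next
    assume "\<exists>M. family_matching \<epsilon> I L J L' M"
    then obtain M where "family_matching \<epsilon> I L J L' M" ..
    then show "\<exists>M. family_matching \<epsilon> (bar_index ?B) fst (bar_index ?B') fst M"
      by (intro exI) (rule family_matching_reindex[where K = fst and K' = fst and L = L and L' = L', OF _ s t])
  qed
qed

theorem theorem5p2:
  fixes F :: "('a, 'm) ring_scheme"
    and U :: "('a, 'v) pmod"
    and V :: "('a, 'w) pmod"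
  assumes "persistence_module F U" and "finite_type F U"
    and "persistence_module F V" and "finite_type F V"
  shows "(\<forall>\<epsilon>\<ge>0. interleaved F \<epsilon> U V \<longleftrightarrow> eps_matched \<epsilon> (bar F U) (bar F V)) \<and>
         interleaving_dist F U V = bottleneck_dist (bar F U) (bar F V)"
proof -
  obtain I L where U: "interval_decomposition F U I L"
    using assms(2) unfolding finite_type_def by blast
  obtain J L' where V: "interval_decomposition F V J L'"
    using assms(4) unfolding finite_type_def by blast
  have "field F" using assms(1) by (rule persistence_module.field)
  have "finite I" "finite J" using U V unfolding interval_decomposition_def by auto
  then have iff: "\<forall>\<epsilon>\<ge>0. interleaved F \<epsilon> U V \<longleftrightarrow> eps_matched \<epsilon> (bar F U) (bar F V)"
    using interleaved_iff_family_matching[OF \<open>field F\<close> _ U V]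
    by (simp add: bar_eq[OF assms(1) U] bar_eq[OF assms(3) V] eps_matched_iff_family_matching)
  then have "{ereal \<epsilon> | \<epsilon>. \<epsilon> > 0 \<and> interleaved F \<epsilon> U V} =
      {ereal \<epsilon> | \<epsilon>. \<epsilon> > 0 \<and> eps_matched \<epsilon> (bar F U) (bar F V)}"
    using less_imp_le by blast
  with iff show ?thesis by (simp add: interleaving_dist_def bottleneck_dist_def)
qed

end
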